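(* Suppose that $0<\tau_i<2/L_i$ for all $i\in\{1,\dots,N\}$, $0<\beta\le0.5/\max_i\tau_i$, and $\varepsilon_k=0$ for all $k\ge0$ (so that $\mathbf d^k=\mathbf 0$ for all $k$, i.e. the proximal mappings are computed exactly). Then the sequences generated by the recursion (D-iPGM) described in the context satisfy, for every integer $k\ge0$, $$\|\mathbf M(\mathbf u^{k+1}-\tilde{\mathbf u}^{k+1})\|_{\mathbf H}^2\le\|\mathbf M(\mathbf u^k-\tilde{\mathbf u}^k)\|_{\mathbf H}^2.$$ Moreover, as $k\to\infty$: 1. (successive difference) $\displaystyle\|\mathbf u^{k+1}-\mathbf u^k\|_{\mathbf H}^2=o\Big(\frac1{k+1}\Big)$; 2. (first-order optimality residual) $\displaystyle\mathrm{dist}^2(\mathbf 0,\mathcal J(\tilde{\mathbf u}^k))=o\Big(\frac1{k+1}\Big)$.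
   Context: Problem. Let $N,n\ge1$ and consider $\min_{\mathrm x\in\mathbb R^n}\sum_{i=1}^N (f_i(\mathrm x)+g_i(\mathrm x))$, where each $f_i:\mathbb R^n\to\mathbb R$ is convex and $L_i$-smooth (differentiable with $L_i$-Lipschitz gradient, $L_i>0$), and each $g_i:\mathbb R^n\to\mathbb R\cup\{\infty\}$ is proper, closed and convex (not necessarily smooth). An optimal solution is assumed to exist. For $\mathbf x=\mathrm{col}\{\mathrm x_1,\dots,\mathrm x_N\}\in\mathbb R^{Nn}$ (stacked vector) put $F(\mathbf x)=\sum_i f_i(\mathrm x_i)$, $G(\mathbf x)=\sum_i g_i(\mathrm x_i)$. Network. $\mathcal G=(\mathcal V,\mathcal E)$ is an undirected connected graph on $N$ vertices. $W=[W_{ij}]\in\mathbb R^{N\times N}$ is symmetric and doubly stochastic, the null space of $\mathbf I-W$ is $\mathrm{Span}(\mathbf 1)$, $W_{ij}=W_{ji}=0$ if $(i,j)\notin\mathcal E$ and $i\ne j$, and $W_{ij}>0$ otherwise. Let $\mathbf W=W\otimes\mathbf I_n$ and $\mathbf V=\sqrt{\mathbf I-\mathbf W}$ (positive semidefinite square root). The problem is equivalent to $\min_{\mathbf x}F(\mathbf x)+G(\mathbf x)$ subject to $\mathbf V\mathbf x=\mathbf 0$. Saddle points and KKT mapping. $\mathcal M=\mathbb R^{Nn}\times\mathbb R^{Nn}$, $L(\mathbf x,\boldsymbol\alpha)=F(\mathbf x)+G(\mathbf x)-\langle\boldsymbol\alpha,\mathbf V\mathbf x\rangle$, and $\mathcal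 M^*\subseteq\mathcal M$ is the set of $(\mathbf x^*,\boldsymbol\alpha^* )$ with $L(\mathbf x^*,\boldsymbol\alpha)\le L(\mathbf x^*,\boldsymbol\alpha^* )\le L(\mathbf x,\boldsymbol\alpha^* )$ for all $(\mathbf x,\boldsymbol\alpha)\in\mathcal M$. Strong duality is assumed, so that $\mathcal M^*\neq\emptyset$. The KKT mapping is the set-valued map $$\mathcal J(\mathbf u)=\begin{pmatrix}\partial G(\mathbf x)+\nabla F(\mathbf x)-\mathbf V\boldsymbol\alpha\\ \mathbf V\mathbf x\end{pmatrix},\qquad \mathbf u=\mathrm{col}\{\mathbf x,\boldsymbol\alpha\},$$ and $\mathrm{dist}(\mathbf 0,\mathcal J(\mathbf u))$ is the Euclidean distance from $\mathbf 0$ to this set. Norms. For a symmetric positive definite matrix $\mathcal H$, $\|\mathbf z\|_{\mathcal H}^2=\langle\mathbf z,\mathcal H\mathbf z\rangle$ and $\mathrm{prox}_\theta^{\mathcal H}(\mathbf x)=\arg\min_{\mathbf y}\{\theta(\mathbf y)+\tfrac12\|\mathbf y-\mathbf x\|_{\mathcal H}^2\}$. Matrices. With $\tau_i>0$, $\beta>0$, $\Gamma=\mathrm{diag}\{\tau_1\mathbf I_n,\dots,\tau_N\mathbf I_n\}$, set $$\mathbf Q=\begin{pmatrix}\Gamma^{-1}&\mathbf V\\ \mathbf 0&\frac1\beta\mathbf I\end{pmatrix},\quad \mathbf M=\begin{pmatrix}\mathbf I&\Gamma\mathbf V\\ \mathbf 0&\mathbf I\end{pmatrix},\quad \mathbf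 H=\mathbf Q\mathbf M^{-1}.$$ Algorithm (D-iPGM). Let $\{\varepsilon_k\}$ be a sequence of nonnegative numbers. Starting from any $\mathbf x^0\in\mathbb R^{Nn}$ and $\boldsymbol\alpha^0=\mathbf 0$, for $k\ge0$, $$\tilde{\mathbf x}^k=\mathrm{prox}_G^{\Gamma^{-1}}\big(\mathbf x^k-\Gamma(\nabla F(\mathbf x^k)-\mathbf V\boldsymbol\alpha^k-\mathbf d^k)\big),\quad \tilde{\boldsymbol\alpha}^k=\boldsymbol\alpha^k-\beta\mathbf V\tilde{\mathbf x}^k,\quad \mathbf u^{k+1}=\mathbf u^k-\mathbf M(\mathbf u^k-\tilde{\mathbf u}^k),$$ where $\mathbf u^k=\mathrm{col}\{\mathbf x^k,\boldsymbol\alpha^k\}$, $\tilde{\mathbf u}^k=\mathrm{col}\{\tilde{\mathbf x}^k,\tilde{\boldsymbol\alpha}^k\}$, and $\mathbf d^k=\mathrm{col}\{\mathrm d_1^k,\dots,\mathrm d_N^k\}$ is an error vector with $\|\mathrm d_i^k\|\le\varepsilon_k$ for all $i$. *)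

theory Defs
  imports "HOL-Analysis.Analysis" "HOL-Library.Landau_Symbols"
begin

text \<open>
  Agents are indexed by a finite type \<open>'N\<close> (so \<open>N = CARD('N)\<close>) and \<open>\<real>\<^sup>n\<close> is \<open>real ^ 'n\<close>.
  A stacked vector in \<open>\<real>\<^sup>N\<^sup>n\<close> has type \<open>real ^ ('N \<times> 'n)\<close>, the pair \<open>(i, j)\<close> standing for coordinate
  \<open>j\<close> of agent \<open>i\<close>; a pair \<open>col{x, \<alpha>}\<close> has type \<open>real ^ ('N \<times> 'n + 'N \<times> 'n)\<close>.
\<close>

definition agent :: "'N::finite \<Rightarrow> real ^ ('N \<times> 'n::finite) \<Rightarrow> real ^ 'n" where
  "agent i x = (\<chi> j. x $ (i, j))"

definition col :: "real ^ 'p::finite \<Rightarrow> real ^ 'q::finite \<Rightarrow> real ^ ('p + 'q)" where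
  "col x a = (\<chi> s. case s of Inl p \<Rightarrow> x $ p | Inr q \<Rightarrow> a $ q)"

definition upper :: "real ^ ('p::finite + 'q::finite) \<Rightarrow> real ^ 'p" where
  "upper u = (\<chi> p. u $ Inl p)"

definition lower :: "real ^ ('p::finite + 'q::finite) \<Rightarrow> real ^ 'q" where
  "lower u = (\<chi> q. u $ Inr q)"


subsection \<open>Functions\<close>

definition grad :: "('a::real_inner \<Rightarrow> real) \<Rightarrow> 'a \<Rightarrow> 'a" where
  "grad f x = (THE D. GDERIV f x :> D)"

definition smooth_with :: "real \<Rightarrow> ('a::real_inner \<Rightarrow> real) \<Rightarrow> bool" where
  "smooth_with L f \<longleftrightarrow> (\<forall>x. f differentiable (at x)) \<and> L-lipschitz_on UNIV (grad f)"

definition proper_fun :: "('a \<Rightarrow> ereal) \<Rightarrow> bool" where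
  "proper_fun h \<longleftrightarrow> (\<forall>x. h x \<noteq> -\<infinity>) \<and> (\<exists>x. h x \<noteq> \<infinity>)"

text \<open>The library notion \<open>epigraph\<close> is for real-valued functions only.\<close>

definition epi :: "('a \<Rightarrow> ereal) \<Rightarrow> ('a \<times> real) set" where
  "epi h = {(x, r). h x \<le> ereal r}"

definition closed_fun :: "('a::topological_space \<Rightarrow> ereal) \<Rightarrow> bool" where
  "closed_fun h \<longleftrightarrow> closed (epi h)"

definition convex_fun :: "('a::real_vector \<Rightarrow> ereal) \<Rightarrow> bool" where
  "convex_fun h \<longleftrightarrow> convex (epi h)"

text \<open>For proper \<open>h\<close> this is empty at every point where \<open>h\<close> takes the value \<open>\<infinity>\<close>.\<close>

definition subdiff :: "('a::real_inner \<Rightarrow> ereal) \<Rightarrow> 'a \<Rightarrow> 'a set" where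
  "subdiff h x = {p. \<forall>y. h y \<ge> h x + ereal (p \<bullet> (y - x))}"

definition sum_F :: "('N::finite \<Rightarrow> real ^ 'n::finite \<Rightarrow> real) \<Rightarrow> real ^ ('N \<times> 'n) \<Rightarrow> real" where
  "sum_F f x = (\<Sum>i\<in>UNIV. f i (agent i x))"

definition sum_G :: "('N::finite \<Rightarrow> real ^ 'n::finite \<Rightarrow> ereal) \<Rightarrow> real ^ ('N \<times> 'n) \<Rightarrow> ereal" where
  "sum_G g x = (\<Sum>i\<in>UNIV. g i (agent i x))"


subsection \<open>Matrices\<close>

definition kron :: "real ^ 'a::finite ^ 'b::finite \<Rightarrow> real ^ 'c::finite ^ 'd::finite
    \<Rightarrow> real ^ ('a \<times> 'c) ^ ('b \<times> 'd)" where
  "kron A B = (\<chi> p q. A $ fst p $ fst q * B $ snd p $ snd q)"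

definition block_mat :: "real ^ 'p::finite ^ 'p \<Rightarrow> real ^ 'q::finite ^ 'p \<Rightarrow> real ^ 'p ^ 'q
    \<Rightarrow> real ^ 'q ^ 'q \<Rightarrow> real ^ ('p + 'q) ^ ('p + 'q)" where
  "block_mat A B C D =
     (\<chi> s t. case (s, t) of
        (Inl p, Inl p') \<Rightarrow> A $ p $ p'
      | (Inl p, Inr q') \<Rightarrow> B $ p $ q'
      | (Inr q, Inl p') \<Rightarrow> C $ q $ p'
      | (Inr q, Inr q') \<Rightarrow> D $ q $ q')"

definition pos_semidef :: "real ^ 'p::finite ^ 'p \<Rightarrow> bool" where
  "pos_semidef A \<longleftrightarrow> transpose A = A \<and> (\<forall>x. 0 \<le> x \<bullet> (A *v x))"

text \<open>\<open>V\<close> is the positive semidefinite square root of \<open>A\<close> (it exists and is unique when \<open>A\<close> is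
  itself positive semidefinite).\<close>

definition is_psd_sqrt :: "real ^ 'p::finite ^ 'p \<Rightarrow> real ^ 'p ^ 'p \<Rightarrow> bool" where
  "is_psd_sqrt V A \<longleftrightarrow> pos_semidef V \<and> V ** V = A"

definition doubly_stochastic :: "real ^ 'N::finite ^ 'N \<Rightarrow> bool" where
  "doubly_stochastic W \<longleftrightarrow> (\<forall>i j. 0 \<le> W $ i $ j) \<and>
     (\<forall>i. (\<Sum>j\<in>UNIV. W $ i $ j) = 1) \<and> (\<forall>j. (\<Sum>i\<in>UNIV. W $ i $ j) = 1)"

definition Gamma_mat :: "('N::finite \<Rightarrow> real) \<Rightarrow> real ^ ('N \<times> 'n::finite) ^ ('N \<times> 'n)" where
  "Gamma_mat \<tau> = (\<chi> p q. if p = q then \<tau> (fst p) else 0)"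

definition Q_mat :: "('N::finite \<Rightarrow> real) \<Rightarrow> real \<Rightarrow> real ^ ('N \<times> 'n::finite) ^ ('N \<times> 'n)
    \<Rightarrow> real ^ ('N \<times> 'n + 'N \<times> 'n) ^ ('N \<times> 'n + 'N \<times> 'n)" where
  "Q_mat \<tau> \<beta> V = block_mat (matrix_inv (Gamma_mat \<tau>)) V 0 (mat (1 / \<beta>))"

definition M_mat :: "('N::finite \<Rightarrow> real) \<Rightarrow> real ^ ('N \<times> 'n::finite) ^ ('N \<times> 'n)
    \<Rightarrow> real ^ ('N \<times> 'n + 'N \<times> 'n) ^ ('N \<times> 'n + 'N \<times> 'n)" where
  "M_mat \<tau> V = block_mat (mat 1) (Gamma_mat \<tau> ** V) 0 (mat 1)"

definition H_mat :: "('N::finite \<Rightarrow> real) \<Rightarrow> real \<Rightarrow> real ^ ('N \<times> 'n::finite) ^ ('N \<times> 'n)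
    \<Rightarrow> real ^ ('N \<times> 'n + 'N \<times> 'n) ^ ('N \<times> 'n + 'N \<times> 'n)" where
  "H_mat \<tau> \<beta> V = Q_mat \<tau> \<beta> V ** matrix_inv (M_mat \<tau> V)"

text \<open>The squared weighted norm \<open>\<parallel>z\<parallel>\<^sub>H\<^sup>2\<close>.\<close>

definition sqnorm :: "real ^ 'p::finite ^ 'p \<Rightarrow> real ^ 'p \<Rightarrow> real" where
  "sqnorm H z = z \<bullet> (H *v z)"

definition prox :: "real ^ 'p::finite ^ 'p \<Rightarrow> (real ^ 'p \<Rightarrow> ereal) \<Rightarrow> real ^ 'p \<Rightarrow> real ^ 'p" where
  "prox H \<theta> x = arg_min (\<lambda>y. \<theta> y + ereal (1 / 2 * sqnorm H (y - x))) (\<lambda>_. True)"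


subsection \<open>Saddle points, KKT mapping and the algorithm\<close>

definition lagrangian :: "('N::finite \<Rightarrow> real ^ 'n::finite \<Rightarrow> real) \<Rightarrow> ('N \<Rightarrow> real ^ 'n \<Rightarrow> ereal)
    \<Rightarrow> real ^ ('N \<times> 'n) ^ ('N \<times> 'n) \<Rightarrow> real ^ ('N \<times> 'n) \<Rightarrow> real ^ ('N \<times> 'n) \<Rightarrow> ereal" where
  "lagrangian f g V x a = ereal (sum_F f x) + sum_G g x - ereal (a \<bullet> (V *v x))"

definition saddle_points :: "('N::finite \<Rightarrow> real ^ 'n::finite \<Rightarrow> real) \<Rightarrow> ('N \<Rightarrow> real ^ 'n \<Rightarrow> ereal)
    \<Rightarrow> real ^ ('N \<times> 'n) ^ ('N \<times> 'n) \<Rightarrow> ((real ^ ('N \<times> 'n)) \<times> (real ^ ('N \<times> 'n))) set" where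
  "saddle_points f g V = {(xs, as). \<forall>x a.
     lagrangian f g V xs a \<le> lagrangian f g V xs as \<and>
     lagrangian f g V xs as \<le> lagrangian f g V x as}"

text \<open>\<open>infdist 0 (KKT f g V u)\<close> is the genuine distance only where this set is nonempty: the library
  sets \<open>infdist a {} = 0\<close>.\<close>

definition KKT :: "('N::finite \<Rightarrow> real ^ 'n::finite \<Rightarrow> real) \<Rightarrow> ('N \<Rightarrow> real ^ 'n \<Rightarrow> ereal)
    \<Rightarrow> real ^ ('N \<times> 'n) ^ ('N \<times> 'n) \<Rightarrow> real ^ ('N \<times> 'n + 'N \<times> 'n)
    \<Rightarrow> (real ^ ('N \<times> 'n + 'N \<times> 'n)) set" where
  "KKT f g V u =
     {col (p + grad (sum_F f) (upper u) - V *v lower u) (V *v upper u) | p.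
        p \<in> subdiff (sum_G g) (upper u)}"

text \<open>The sequence \<open>ut\<close> is \<open>u\<close> with a tilde, \<open>d\<close> is the error sequence; the initial primal
  point \<open>upper (u 0)\<close> is arbitrary.\<close>

definition DiPGM :: "('N::finite \<Rightarrow> real ^ 'n::finite \<Rightarrow> real) \<Rightarrow> ('N \<Rightarrow> real ^ 'n \<Rightarrow> ereal)
    \<Rightarrow> ('N \<Rightarrow> real) \<Rightarrow> real \<Rightarrow> real ^ ('N \<times> 'n) ^ ('N \<times> 'n)
    \<Rightarrow> (nat \<Rightarrow> real ^ ('N \<times> 'n))
    \<Rightarrow> (nat \<Rightarrow> real ^ ('N \<times> 'n + 'N \<times> 'n)) \<Rightarrow> (nat \<Rightarrow> real ^ ('N \<times> 'n + 'N \<times> 'n)) \<Rightarrow> bool" where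
  "DiPGM f g \<tau> \<beta> V d u ut \<longleftrightarrow>
     lower (u 0) = 0 \<and>
     (\<forall>k. upper (ut k) =
            prox (matrix_inv (Gamma_mat \<tau>)) (sum_G g)
              (upper (u k) - Gamma_mat \<tau> *v (grad (sum_F f) (upper (u k)) - V *v lower (u k) - d k)) \<and>
          lower (ut k) = lower (u k) - \<beta> *\<^sub>R (V *v upper (ut k)) \<and>
          u (Suc k) = u k - M_mat \<tau> V *v (u k - ut k))"

end

theory Submission
  imports Defs
begin

text \<open>
  Since \<open>H = diag(\<Gamma>\<^sup>-\<^sup>1, I/\<beta>)\<close>, one iteration is a map whose increments satisfy, by monotonicity of
  \<open>\<partial>G\<close> and cocoercivity of \<open>\<nabla>F\<close>, the estimate
  \<open>\<parallel>\<Delta>u\<parallel>\<^sub>H\<^sup>2 - \<parallel>\<Delta>u\<^sup>+\<parallel>\<^sub>H\<^sup>2 \<ge> c \<parallel>\<Delta>(u - u')\<parallel>\<^sup>2\<close>. Here \<open>u'\<close> is the prediction \<open>ut\<close>. The constant \<open>c\<close> is positive because \<open>\<tau>\<^sub>i < 2/L\<^sub>i\<close>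
  and because the positive diagonal of \<open>W\<close> makes \<open>V\<^sup>2 = I - W\<close> strictly smaller than \<open>2I\<close>. Applied to two
  consecutive iterates, the estimate shows that \<open>\<parallel>u\<^sup>k\<^sup>+\<^sup>1 - u\<^sup>k\<parallel>\<^sub>H\<close> decreases; applied to an iterate and a
  saddle point, which is a fixed point, it shows that the squares are summable. A decreasing summable sequence is
  \<open>o(1/(k+1))\<close>, and the optimality residual is bounded by a multiple of \<open>\<parallel>u\<^sup>k - u'\<^sup>k\<parallel>\<close>.
\<close>

subsection \<open>Smooth convex functions\<close>

lemma GDERIV_unique:
  fixes D D' :: "'a::real_inner"
  assumes "GDERIV f x :> D" "GDERIV f x :> D'"
  shows "D = D'"
proof -
  have "(\<lambda>h. h \<bullet> D) = (\<lambda>h. h \<bullet> D')"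
    using assms unfolding gderiv_def by (rule has_derivative_unique)
  then have "(D - D') \<bullet> D = (D - D') \<bullet> D'" by (rule fun_cong)
  then have "(D - D') \<bullet> (D - D') = 0" by (simp only: inner_diff_right)
  then show ?thesis by simp
qed

lemma grad_eqI: "GDERIV f x :> D \<Longrightarrow> grad f x = D"
  unfolding grad_def by (blast intro: GDERIV_unique)

text \<open>The adjoint of the derivative, evaluated at \<open>1\<close>, is its Riesz
  representative, so the definite description in \<open>grad\<close> denotes an actual
  gradient.\<close>

lemma GDERIV_grad:
  fixes f :: "'a::euclidean_space \<Rightarrow> real"
  assumes "f differentiable (at x)"
  shows "GDERIV f x :> grad f x"
proof -
  obtain f' where f': "(f has_derivative f') (at x)"
    using assms by (auto simp: differentiable_def)
  have "f' = (\<lambda>h. h \<bullet> adjoint f' 1)"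
    using adjoint_works[OF has_derivative_linear[OF f'], of _ 1] by simp
  then have "GDERIV f x :> adjoint f' 1"
    using f' unfolding gderiv_def by simp
  then show ?thesis by (metis grad_eqI)
qed

lemma GDERIV_along_line:
  assumes "GDERIV f (x + t *\<^sub>R v) :> D"
  shows "((\<lambda>s. f (x + s *\<^sub>R v)) has_real_derivative D \<bullet> v) (at t)"
proof -
  have "((\<lambda>s. x + s *\<^sub>R v) has_derivative (\<lambda>h. h *\<^sub>R v)) (at t)"
    by (auto intro!: derivative_eq_intros)
  moreover have "(f has_derivative (\<lambda>h. h \<bullet> D)) (at (x + t *\<^sub>R v))"
    using assms by (simp add: gderiv_def)
  ultimately have "((\<lambda>s. f (x + s *\<^sub>R v)) has_derivative (\<lambda>h. (h *\<^sub>R v) \<bullet> D)) (at t)"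
    by (rule has_derivative_compose)
  moreover have "(\<lambda>h. (h *\<^sub>R v) \<bullet> D) = (*) (D \<bullet> v)"
    by (auto simp: inner_commute)
  ultimately show ?thesis by (simp add: has_field_derivative_def)
qed

text \<open>Restriction to the line through \<open>x\<close> and \<open>y\<close> reduces the claim
  to the one-dimensional tangent inequality.\<close>

lemma convex_GDERIV_above_tangent:
  assumes "convex_on UNIV f" and "GDERIV f x :> D"
  shows "f x + D \<bullet> (y - x) \<le> f y"
proof -
  let ?\<phi> = "\<lambda>t. f (x + t *\<^sub>R (y - x))"
  have "convex_on UNIV ?\<phi>"
  proof (rule convex_onI)
    fix t a b :: real
    assume "0 < t" "t < 1"
    have "x + ((1 - t) *\<^sub>R a + t *\<^sub>R b) *\<^sub>R (y - x)
        = (1 - t) *\<^sub>R (x + a *\<^sub>R (y - x)) + t *\<^sub>R (x + b *\<^sub>R (y - x))"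
      by (simp add: algebra_simps)
    then show "?\<phi> ((1 - t) *\<^sub>R a + t *\<^sub>R b) \<le> (1 - t) * ?\<phi> a + t * ?\<phi> b"
      using convex_onD[OF assms(1), of t "x + a *\<^sub>R (y - x)" "x + b *\<^sub>R (y - x)"] \<open>0 < t\<close> \<open>t < 1\<close>
      by simp
  qed simp
  moreover have "(?\<phi> has_real_derivative D \<bullet> (y - x)) (at 0)"
    using assms(2) by (intro GDERIV_along_line) simp
  ultimately have "?\<phi> 1 - ?\<phi> 0 \<ge> D \<bullet> (y - x) * (1 - 0)"
    by (intro convex_on_imp_above_tangent[where A = UNIV]) auto
  then show ?thesis by simp
qed

text \<open>The descent lemma, obtained from monotonicity along the segment instead of integrating
  the gradient.\<close>

lemma lipschitz_gradient_upper_bound: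
  assumes G: "\<And>z. GDERIV f z :> G z" and lip: "L-lipschitz_on UNIV G"
  shows "f (x + v) \<le> f x + G x \<bullet> v + L / 2 * (norm v)\<^sup>2"
proof -
  \<comment> \<open>This is \<open>f\<close> along the segment minus its quadratic majorant, up to
    the constant \<open>f x\<close>; Cauchy-Schwarz and the Lipschitz bound make its derivative
    nonpositive.\<close>
  let ?\<phi> = "\<lambda>t. f (x + t *\<^sub>R v) - t * (G x \<bullet> v) - L / 2 * t\<^sup>2 * (norm v)\<^sup>2"
  have "?\<phi> 0 \<ge> ?\<phi> 1"
  proof (rule DERIV_nonpos_imp_nonincreasing[where f = ?\<phi>])
    fix t :: real assume t: "0 \<le> t" "t \<le> 1"
    have "(G (x + t *\<^sub>R v) - G x) \<bullet> v \<le> norm (G (x + t *\<^sub>R v) - G x) * norm v"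
      by (rule norm_cauchy_schwarz)
    also have "\<dots> \<le> (L * (t * norm v)) * norm v"
      using lipschitz_onD[OF lip, of "x + t *\<^sub>R v" x] t
      by (intro mult_right_mono) (auto simp: dist_norm)
    finally have "(G (x + t *\<^sub>R v) - G x) \<bullet> v - L * t * (norm v)\<^sup>2 \<le> 0"
      by (simp add: power2_eq_square algebra_simps)
    moreover have "(?\<phi> has_real_derivative (G (x + t *\<^sub>R v) - G x) \<bullet> v - L * t * (norm v)\<^sup>2) (at t)"
      using G[of "x + t *\<^sub>R v"]
      by (auto intro!: derivative_eq_intros GDERIV_along_line simp: inner_diff_left)
    ultimately show "\<exists>y. (?\<phi> has_real_derivative y) (at t) \<and> y \<le> 0" by blast
  qed simp
  then show ?thesis by simp
qed

text \<open>The Baillon-Haddad inequality: \<open>half\<close> sharpens the tangent inequality by a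
  gradient-difference term, and adding its copy with \<open>x\<close> and \<open>y\<close> exchanged
  cancels the function values.\<close>

lemma lipschitz_gradient_cocoercive:
  assumes cvx: "convex_on UNIV f" and G: "\<And>z. GDERIV f z :> G z"
    and lip: "L-lipschitz_on UNIV G" and "L > 0"
  shows "1 / L * (norm (G x - G y))\<^sup>2 \<le> (G x - G y) \<bullet> (x - y)"
proof -
  have half: "f x \<le> f y + G x \<bullet> (x - y) - 1 / (2 * L) * (norm (G y - G x))\<^sup>2" for x y
  proof -
    define w where "w = G y - G x"
    \<comment> \<open>A gradient step of length \<open>1 / L\<close> from \<open>y\<close> for
      \<open>f\<close> minus the linear form with gradient \<open>G x\<close>; it minimizes the
      quadratic majorant of that function at \<open>y\<close>.\<close>
    define z where "z = y + (- (1 / L)) *\<^sub>R w"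
    have "f x + G x \<bullet> (z - x) \<le> f z"
      by (rule convex_GDERIV_above_tangent[OF cvx G])
    also have "f z \<le> f y + G y \<bullet> ((- (1 / L)) *\<^sub>R w) + L / 2 * (norm ((- (1 / L)) *\<^sub>R w))\<^sup>2"
      unfolding z_def by (rule lipschitz_gradient_upper_bound[OF G lip])
    also have "L / 2 * (norm ((- (1 / L)) *\<^sub>R w))\<^sup>2 = 1 / (2 * L) * (w \<bullet> w)"
      using \<open>L > 0\<close> by (simp add: power_mult_distrib power2_norm_eq_inner[symmetric] power2_eq_square field_simps)
    finally have "f x \<le> f y + G x \<bullet> (x - y) - 1 / L * (w \<bullet> w) + 1 / (2 * L) * (w \<bullet> w)"
      by (simp add: z_def w_def algebra_simps)
    moreover have "- 1 / L * (w \<bullet> w) + 1 / (2 * L) * (w \<bullet> w) = - 1 / (2 * L) * (w \<bullet> w)"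
      using \<open>L > 0\<close> by (simp add: field_simps)
    ultimately show ?thesis
      unfolding w_def[symmetric] power2_norm_eq_inner by linarith
  qed
  have "1 / L * (norm (G x - G y))\<^sup>2
      = 1 / (2 * L) * (norm (G y - G x))\<^sup>2 + 1 / (2 * L) * (norm (G x - G y))\<^sup>2"
    using \<open>L > 0\<close> by (simp add: norm_minus_commute field_simps)
  with half[of x y] half[of y x] show ?thesis
    by (simp add: algebra_simps)
qed

text \<open>For an increment \<open>z\<close> other than \<open>x - y\<close>, cocoercivity still
  controls the pairing up to the squared mismatch. This matters because gradients are taken at the
  current iterates while the subgradients belong to the predictions.\<close>

lemma lipschitz_gradient_three_points:
  assumes cvx: "convex_on UNIV f" and G: "\<And>z. GDERIV f z :> G z"
    and lip: "L-lipschitz_on UNIV G" and "L > 0"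
  shows "(G x - G y) \<bullet> z \<ge> - (L / 4) * (norm (x - y - z))\<^sup>2"
proof -
  define w e where "w = G x - G y" and "e = x - y - z"
  \<comment> \<open>The shift \<open>L / 2\<close> completes the square so that the multiple of
    \<open>w \<bullet> w\<close> is exactly the one that cocoercivity absorbs; the leftover constant
    is \<open>L / 4\<close>.\<close>
  have "0 \<le> 1 / L * (norm (w - (L / 2) *\<^sub>R e))\<^sup>2"
    using \<open>L > 0\<close> by simp
  also have "\<dots> = 1 / L * (w \<bullet> w) - w \<bullet> e + L / 4 * (e \<bullet> e)"
    unfolding power2_norm_eq_inner using \<open>L > 0\<close>
    by (simp add: inner_diff inner_commute field_simps power2_eq_square)
  finally have "w \<bullet> e \<le> 1 / L * (w \<bullet> w) + L / 4 * (e \<bullet> e)" by simp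
  moreover have "1 / L * (w \<bullet> w) \<le> w \<bullet> (x - y)"
    using lipschitz_gradient_cocoercive[OF assms, of x y] by (simp add: w_def power2_norm_eq_inner)
  moreover have "w \<bullet> z = w \<bullet> (x - y) - w \<bullet> e"
    by (simp add: e_def algebra_simps)
  ultimately show ?thesis
    unfolding w_def[symmetric] e_def[symmetric] power2_norm_eq_inner by simp
qed

subsection \<open>Subdifferentials and proximal points\<close>

lemma convex_funD:
  assumes "convex_fun h" "h x = ereal a" "h y = ereal b" "0 \<le> t" "t \<le> 1"
  shows "h (x + t *\<^sub>R (y - x)) \<le> ereal (a + t * (b - a))"
proof -
  have "(1 - t) *\<^sub>R (x, a) + t *\<^sub>R (y, b) \<in> epi h"
    using assms by (intro convexD_alt) (auto simp: convex_fun_def epi_def)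
  then show ?thesis
    by (simp add: epi_def algebra_simps)
qed

text \<open>Fermat's rule for a convex plus a differentiable function: along each segment, a
  minimizer has nonnegative one-sided slope.\<close>

lemma minimizer_subdiff:
  assumes h: "proper_fun h" "convex_fun h" and fin: "h x \<noteq> \<infinity>"
    and D: "GDERIV \<phi> x :> D"
    and min: "\<And>y. h x + ereal (\<phi> x) \<le> h y + ereal (\<phi> y)"
  shows "- D \<in> subdiff h x"
proof -
  obtain a where a: "h x = ereal a"
    using h(1) fin by (cases "h x") (auto simp: proper_fun_def)
  have "h x + ereal (- D \<bullet> (y - x)) \<le> h y" for y
  proof (cases "h y")
    case (real b)
    \<comment> \<open>On the segment \<open>h\<close> is replaced by its chord (without the constant
      \<open>a\<close>), an upper bound by convexity that is exact at \<open>x\<close>; the result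
      is real-valued and differentiable.\<close>
    define \<psi> where "\<psi> t = \<phi> (x + t *\<^sub>R (y - x)) + t * (b - a)" for t
    have deriv: "(\<psi> has_real_derivative D \<bullet> (y - x) + (b - a)) (at 0)"
      unfolding \<psi>_def using D by (auto intro!: derivative_eq_intros GDERIV_along_line)
    have "D \<bullet> (y - x) + (b - a) \<ge> 0"
    proof (rule ccontr)
      assume "\<not> ?thesis"
      then obtain r where r: "r > 0" "\<And>t. 0 < t \<Longrightarrow> t < r \<Longrightarrow> \<psi> (0 + t) < \<psi> 0"
        using DERIV_neg_dec_right[OF deriv] by (auto simp: not_le)
      define t where "t = min (r / 2) 1"
      have t: "0 < t" "t < r" "t \<le> 1" using r(1) by (auto simp: t_def)
      have "h x + ereal (\<phi> x) \<le> h (x + t *\<^sub>R (y - x)) + ereal (\<phi> (x + t *\<^sub>R (y - x)))"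
        by (rule min)
      also have "\<dots> \<le> ereal (a + t * (b - a)) + ereal (\<phi> (x + t *\<^sub>R (y - x)))"
        using t by (intro add_right_mono convex_funD[OF h(2) a real]) auto
      finally have "\<psi> 0 \<le> \<psi> t"
        by (simp add: a \<psi>_def)
      with r(2)[of t] t show False by simp
    qed
    then show ?thesis by (simp add: a real)
  qed (use h(1) in \<open>auto simp: proper_fun_def\<close>)
  then show ?thesis by (simp add: subdiff_def)
qed

lemma subdiff_finite:
  assumes "proper_fun h" "p \<in> subdiff h x"
  obtains a where "h x = ereal a"
proof -
  obtain y where "h y \<noteq> \<infinity>" using assms(1) by (auto simp: proper_fun_def)
  moreover have "h x + ereal (p \<bullet> (y - x)) \<le> h y"
    using assms(2) by (simp add: subdiff_def)
  ultimately have "h x \<noteq> \<infinity>" by auto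
  with assms(1) that show ?thesis
    by (cases "h x") (auto simp: proper_fun_def)
qed

lemma subdiff_monotone:
  assumes "proper_fun h" "p \<in> subdiff h x" "q \<in> subdiff h y"
  shows "0 \<le> (p - q) \<bullet> (x - y)"
proof -
  obtain a b where ab: "h x = ereal a" "h y = ereal b"
    using assms by (metis subdiff_finite)
  have "h x + ereal (p \<bullet> (y - x)) \<le> h y" "h y + ereal (q \<bullet> (x - y)) \<le> h x"
    using assms by (auto simp: subdiff_def)
  then show ?thesis by (simp add: ab algebra_simps)
qed

text \<open>The subgradient \<open>p\<close> supplies the affine minorant of \<open>h\<close> that makes the objective coercive.\<close>

lemma prox_minimizer_exists:
  fixes h :: "'a::euclidean_space \<Rightarrow> ereal"
  assumes h: "proper_fun h" "closed_fun h" and p: "p \<in> subdiff h x0" and "c > 0"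
  obtains y where "h y \<noteq> \<infinity>"
    "\<And>z. h y + ereal (c * (norm (y - w))\<^sup>2) \<le> h z + ereal (c * (norm (z - w))\<^sup>2)"
proof -
  obtain a where a: "h x0 = ereal a" using subdiff_finite[OF h(1) p] .
  \<comment> \<open>Minimizing over the epigraph trades the extended-valued, lower semicontinuous
    objective for a continuous real function on a closed set.\<close>
  define \<Phi> where "\<Phi> = (\<lambda>(y, r). r + c * (norm (y - w))\<^sup>2)"
  have cont: "continuous_on A \<Phi>" for A
    unfolding \<Phi>_def case_prod_beta by (intro continuous_intros)
  define K where "K = epi h \<inter> {q. \<Phi> q \<le> \<Phi> (x0, a)}"
  have "closed K"
    unfolding K_def using h(2) cont
    by (intro closed_Int closed_Collect_le) (auto simp: closed_fun_def)
  moreover have "bounded K"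
  proof -
    define C where "C = c * (norm (x0 - w))\<^sup>2 + norm p * norm (w - x0)"
    \<comment> \<open>Bounds every \<open>t\<close> with
      \<open>c * t^2 \<le> C + norm p * t\<close>: if \<open>t > 1\<close>, the right side is at
      most \<open>(C + norm p) * t\<close>, and one factor \<open>t\<close> cancels.\<close>
    define B where "B = 1 + (C + norm p) / c"
    have "C \<ge> 0" using \<open>c > 0\<close> by (simp add: C_def)
    have "norm (y - w) \<le> B \<and> a - norm p * (B + norm (w - x0)) \<le> r \<and> r \<le> \<Phi> (x0, a)"
      if "(y, r) \<in> K" for y r
    proof -
      have hy: "h y \<le> ereal r" and r: "r + c * (norm (y - w))\<^sup>2 \<le> \<Phi> (x0, a)"
        using that by (auto simp: K_def epi_def \<Phi>_def)
      have "h x0 + ereal (p \<bullet> (y - x0)) \<le> h y"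
        using p by (simp add: subdiff_def)
      also note hy
      finally have ar: "a + p \<bullet> (y - x0) \<le> r" by (simp add: a)
      have "- (norm p * norm (y - x0)) \<le> p \<bullet> (y - x0)"
        using Cauchy_Schwarz_ineq2[of p "y - x0"] by linarith
      moreover have "norm (y - x0) \<le> norm (y - w) + norm (w - x0)"
        using norm_triangle_ineq[of "y - w" "w - x0"] by simp
      then have "norm p * norm (y - x0) \<le> norm p * (norm (y - w) + norm (w - x0))"
        by (intro mult_left_mono) auto
      ultimately have lower: "a - norm p * (norm (y - w) + norm (w - x0)) \<le> r"
        using ar by linarith
      have "c * (norm (y - w))\<^sup>2 \<le> C + norm p * norm (y - w)"
        using lower r by (simp add: C_def \<Phi>_def algebra_simps)
      have yB: "norm (y - w) \<le> B"
      proof (cases "norm (y - w) \<le> 1")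
        case True
        then show ?thesis using \<open>C \<ge> 0\<close> \<open>c > 0\<close> by (simp add: B_def add_increasing2)
      next
        case False
        then have "C \<le> C * norm (y - w)"
          using \<open>C \<ge> 0\<close> by (simp add: mult_le_cancel_left1)
        then have "norm (y - w) * (c * norm (y - w)) \<le> norm (y - w) * (C + norm p)"
          using \<open>c * (norm (y - w))\<^sup>2 \<le> _\<close> by (simp add: power2_eq_square algebra_simps)
        then have "c * norm (y - w) \<le> C + norm p"
          using False by (subst (asm) mult_le_cancel_left_pos) auto
        then show ?thesis using \<open>c > 0\<close> by (simp add: B_def field_simps)
      qed
      have "norm p * (norm (y - w) + norm (w - x0)) \<le> norm p * (B + norm (w - x0))"
        using yB by (intro mult_left_mono) auto
      then have "a - norm p * (B + norm (w - x0)) \<le> r"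
        using lower by linarith
      moreover have "r \<le> \<Phi> (x0, a)"
        using r \<open>c > 0\<close> by (smt (verit) mult_nonneg_nonneg zero_le_power2)
      ultimately show ?thesis using yB by blast
    qed
    then have "K \<subseteq> cball w B \<times> {a - norm p * (B + norm (w - x0)) .. \<Phi> (x0, a)}"
      by (auto simp: dist_norm norm_minus_commute)
    then show ?thesis
      by (rule bounded_subset[rotated]) (intro bounded_Times bounded_cball bounded_closed_interval)
  qed
  moreover have x0: "(x0, a) \<in> K" by (simp add: K_def epi_def a)
  ultimately obtain q where q: "q \<in> K" "\<And>q'. q' \<in> K \<Longrightarrow> \<Phi> q \<le> \<Phi> q'"
    using continuous_attains_inf[OF _ _ cont, of K]
    by (metis compact_eq_bounded_closed empty_iff)
  obtain y r where yr: "q = (y, r)" by fastforce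
  have hy: "h y \<le> ereal r" using q(1) by (simp add: K_def epi_def yr)
  show ?thesis
  proof
    show "h y \<noteq> \<infinity>" using hy by auto
    fix z
    have "h y + ereal (c * (norm (y - w))\<^sup>2) \<le> ereal r + ereal (c * (norm (y - w))\<^sup>2)"
      using hy by (rule add_right_mono)
    also have "\<dots> = ereal (\<Phi> q)" by (simp add: yr \<Phi>_def)
    also have "\<dots> \<le> h z + ereal (c * (norm (z - w))\<^sup>2)"
    proof (cases "h z")
      case (real b)
      have "\<Phi> q \<le> \<Phi> (z, b)"
      proof (cases "(z, b) \<in> K")
        case False
        then have "\<Phi> (x0, a) \<le> \<Phi> (z, b)" by (auto simp: K_def epi_def real)
        then show ?thesis using q(2)[OF x0] by linarith
      qed (rule q(2))
      then show ?thesis by (simp add: real \<Phi>_def)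
    qed (use h(1) in \<open>auto simp: proper_fun_def\<close>)
    finally show "h y + ereal (c * (norm (y - w))\<^sup>2) \<le> h z + ereal (c * (norm (z - w))\<^sup>2)" .
  qed
qed

subsection \<open>Stacked vectors\<close>

text \<open>The inverse of the decomposition into blocks \<open>agent i x\<close>; it assembles
  gradients, minimizers and test points agent by agent.\<close>

definition stack :: "('N::finite \<Rightarrow> real ^ 'n::finite) \<Rightarrow> real ^ ('N \<times> 'n)" where
  "stack y = (\<chi> p. y (fst p) $ snd p)"

lemma agent_stack [simp]: "agent i (stack y) = y i"
  by (simp add: agent_def stack_def)

lemma agent_eqI: "(\<And>i. agent i x = agent i y) \<Longrightarrow> x = y"
  by (auto simp: agent_def vec_eq_iff)

lemma bounded_linear_agent: "bounded_linear (agent i)"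
  by (simp add: agent_def vec_eq_iff linear_iff flip: linear_conv_bounded_linear)

lemma agent_linear [simp]:
  "agent i (x + y) = agent i x + agent i y" "agent i (x - y) = agent i x - agent i y"
  "agent i (c *\<^sub>R x) = c *\<^sub>R agent i x" "agent i (- x) = - agent i x" "agent i 0 = 0"
  by (auto simp: agent_def vec_eq_iff)

lemma inner_agents: "x \<bullet> y = (\<Sum>i\<in>UNIV. agent i x \<bullet> agent i y)"
  by (simp add: inner_vec_def agent_def sum.cartesian_product case_prod_beta flip: UNIV_Times_UNIV)

lemma norm_agents: "(norm x)\<^sup>2 = (\<Sum>i\<in>UNIV. (norm (agent i x))\<^sup>2)"
  by (simp add: power2_norm_eq_inner inner_agents[of x x])

lemma GDERIV_sum_F:
  assumes "\<And>i. GDERIV (f i) (agent i x) :> G i"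
  shows "GDERIV (sum_F f) x :> stack G"
proof -
  have "((\<lambda>x. f i (agent i x)) has_derivative (\<lambda>h. agent i h \<bullet> G i)) (at x)" for i
    using assms[of i] has_derivative_compose[OF bounded_linear_imp_has_derivative[OF bounded_linear_agent]]
    by (auto simp: gderiv_def)
  then have "((\<lambda>x. \<Sum>i\<in>UNIV. f i (agent i x)) has_derivative (\<lambda>h. \<Sum>i\<in>UNIV. agent i h \<bullet> G i)) (at x)"
    by (intro has_derivative_sum)
  moreover have "(\<lambda>h. \<Sum>i\<in>UNIV. agent i h \<bullet> G i) = (\<lambda>h. h \<bullet> stack G)"
    by (simp add: inner_agents[of _ "stack G"])
  moreover have "(\<lambda>x. \<Sum>i\<in>UNIV. f i (agent i x)) = sum_F f"
    by (auto simp: sum_F_def)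
  ultimately show ?thesis by (simp add: gderiv_def)
qed

context
  fixes g :: "'N::finite \<Rightarrow> real ^ 'n::finite \<Rightarrow> ereal"
  assumes proper: "\<And>i. proper_fun (g i)"
begin

text \<open>With the value -\<infinity> excluded, one infinite summand would make the whole sum
  infinite.\<close>

lemma sum_G_real:
  assumes "sum_G g x \<noteq> \<infinity>"
  obtains r where "\<And>i. g i (agent i x) = ereal (r i)" "sum_G g x = ereal (\<Sum>i\<in>UNIV. r i)"
proof -
  have "\<bar>g i (agent i x)\<bar> \<noteq> \<infinity>" for i
    using assms proper by (auto simp: sum_G_def sum_Pinfty proper_fun_def)
  then have *: "g i (agent i x) = ereal (real_of_ereal (g i (agent i x)))" for i
    by (simp add: ereal_real')
  then have "sum_G g x = (\<Sum>i\<in>UNIV. ereal (real_of_ereal (g i (agent i x))))"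
    unfolding sum_G_def by presburger
  then show ?thesis by (intro that[OF *]) simp
qed

lemma proper_sum_G: "proper_fun (sum_G g)"
proof -
  have "sum_G g x \<noteq> - \<infinity>" for x
  proof -
    have "(\<Sum>i\<in>A. g i (agent i x)) \<noteq> - \<infinity>" if "finite A" for A
      using that proper by induction (auto simp: ereal_plus_eq_MInfty proper_fun_def)
    then show ?thesis by (simp add: sum_G_def)
  qed
  moreover obtain y where "\<And>i. g i (y i) \<noteq> \<infinity>"
    using proper unfolding proper_fun_def by metis
  then have "sum_G g (stack y) \<noteq> \<infinity>"
    by (auto simp: sum_G_def sum_Pinfty)
  ultimately show ?thesis by (auto simp: proper_fun_def)
qed

lemma convex_sum_G:
  assumes "\<And>i. convex_fun (g i)"
  shows "convex_fun (sum_G g)"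
  unfolding convex_fun_def
proof (rule convexI, clarify)
  fix x y :: "real ^ ('N \<times> 'n)" and a b s t :: real
  assume "(x, a) \<in> epi (sum_G g)" "(y, b) \<in> epi (sum_G g)" and st: "0 \<le> s" "0 \<le> t" "s + t = 1"
  then have ab: "sum_G g x \<le> ereal a" "sum_G g y \<le> ereal b" by (auto simp: epi_def)
  then have "sum_G g x \<noteq> \<infinity>" "sum_G g y \<noteq> \<infinity>" by auto
  then obtain p q where p: "\<And>i. g i (agent i x) = ereal (p i)" "sum_G g x = ereal (\<Sum>i\<in>UNIV. p i)"
    and q: "\<And>i. g i (agent i y) = ereal (q i)" "sum_G g y = ereal (\<Sum>i\<in>UNIV. q i)"
    by (metis sum_G_real)
  have "g i (agent i (s *\<^sub>R x + t *\<^sub>R y)) \<le> ereal (s * p i + t * q i)" for i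
  proof -
    have "s *\<^sub>R (agent i x, p i) + t *\<^sub>R (agent i y, q i) \<in> epi (g i)"
      using assms[of i] st p(1) q(1) unfolding convex_fun_def
      by (intro convexD) (auto simp: epi_def)
    then show ?thesis by (simp add: epi_def)
  qed
  then have "sum_G g (s *\<^sub>R x + t *\<^sub>R y) \<le> (\<Sum>i\<in>UNIV. ereal (s * p i + t * q i))"
    unfolding sum_G_def by (intro sum_mono)
  also have "\<dots> \<le> ereal (s * a + t * b)"
    using ab p(2) q(2) st
    by (auto simp: sum.distrib simp flip: sum_distrib_left intro!: add_mono mult_left_mono)
  finally show "s *\<^sub>R (x, a) + t *\<^sub>R (y, b) \<in> epi (sum_G g)"
    by (simp add: epi_def)
qed

text \<open>Test points that differ from \<open>x\<close> only in block \<open>i\<close> let the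
  other, finite summands cancel. The result provides the affine minorant for each agent's proximal
  problem.\<close>

lemma subdiff_agent:
  assumes "p \<in> subdiff (sum_G g) x"
  shows "agent i p \<in> subdiff (g i) (agent i x)"
proof -
  obtain r where r: "\<And>i. g i (agent i x) = ereal (r i)" "sum_G g x = ereal (\<Sum>i\<in>UNIV. r i)"
  proof -
    obtain a where "sum_G g x = ereal a" by (rule subdiff_finite[OF proper_sum_G assms])
    then have "sum_G g x \<noteq> \<infinity>" by simp
    then show thesis by (rule sum_G_real) (rule that)
  qed
  have "g i (agent i x) + ereal (agent i p \<bullet> (y - agent i x)) \<le> g i y" for y
  proof -
    define z where "z = stack (\<lambda>j. if j = i then y else agent j x)"
    have "p \<bullet> (z - x) = (\<Sum>j\<in>UNIV. if j = i then agent i p \<bullet> (y - agent i x) else 0)"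
      unfolding inner_agents[of p] by (intro sum.cong) (auto simp: z_def)
    then have inner: "p \<bullet> (z - x) = agent i p \<bullet> (y - agent i x)" by simp
    have "sum_G g z = g i y + (\<Sum>j\<in>UNIV - {i}. g j (agent j z))"
      unfolding sum_G_def by (subst sum.remove[of _ i]) (auto simp: z_def)
    also have "(\<Sum>j\<in>UNIV - {i}. g j (agent j z)) = (\<Sum>j\<in>UNIV - {i}. ereal (r j))"
      by (intro sum.cong) (auto simp: z_def r)
    finally have "sum_G g z = g i y + ereal (\<Sum>j\<in>UNIV - {i}. r j)" by simp
    moreover have "sum_G g x + ereal (p \<bullet> (z - x)) \<le> sum_G g z"
      using assms by (simp add: subdiff_def)
    moreover have "(\<Sum>j\<in>UNIV. r j) = r i + (\<Sum>j\<in>UNIV - {i}. r j)"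
      by (subst sum.remove[of _ i]) auto
    ultimately show ?thesis
      by (cases "g i y") (auto simp: r inner)
  qed
  then show ?thesis by (simp add: subdiff_def)
qed

end

subsection \<open>Block matrices\<close>

lemma agent_Gamma [simp]: "agent i (Gamma_mat \<sigma> *v x) = \<sigma> i *\<^sub>R agent i x"
  by (simp add: agent_def Gamma_mat_def matrix_vector_mult_def vec_eq_iff if_distrib[of "\<lambda>c. c * _"] cong: if_cong)

lemma matrix_inv_eqI:
  assumes "A ** B = mat 1" "B ** A = mat 1"
  shows "matrix_inv A = B"
proof -
  have "A ** matrix_inv A = mat 1 \<and> matrix_inv A ** A = mat 1"
    unfolding matrix_inv_def by (rule someI[of _ B]) (use assms in simp)
  then have "matrix_inv A = (B ** A) ** matrix_inv A" using assms(2) by simp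
  also have "\<dots> = B" using \<open>A ** matrix_inv A = mat 1 \<and> _\<close> by (simp add: matrix_mul_assoc[symmetric])
  finally show ?thesis .
qed

lemma matrix_inv_Gamma:
  assumes "\<And>i. \<sigma> i \<noteq> 0"
  shows "matrix_inv (Gamma_mat \<sigma>) = Gamma_mat (\<lambda>i. inverse (\<sigma> i))"
  by (rule matrix_inv_eqI)
     (auto simp: matrix_eq assms matrix_vector_mul_assoc[symmetric] intro!: agent_eqI)

lemma Gamma_inverse_mult:
  assumes "\<And>i. \<sigma> i \<noteq> 0"
  shows "Gamma_mat (\<lambda>i. inverse (\<sigma> i)) *v (Gamma_mat \<sigma> *v x) = x"
  by (auto simp: assms intro!: agent_eqI)

lemma sqnorm_Gamma: "sqnorm (Gamma_mat \<sigma>) x = (\<Sum>i\<in>UNIV. \<sigma> i * (norm (agent i x))\<^sup>2)"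
  by (simp add: sqnorm_def inner_agents[of x] power2_norm_eq_inner)

lemma Gamma_selfadjoint: "x \<bullet> (Gamma_mat \<sigma> *v y) = (Gamma_mat \<sigma> *v x) \<bullet> y"
  unfolding inner_agents by simp

lemma transpose_selfadjoint:
  fixes A :: "real ^ 'p ^ 'p"
  assumes "transpose A = A"
  shows "x \<bullet> (A *v y) = (A *v x) \<bullet> y"
  using dot_lmul_matrix[of x A y] assms by (metis vector_transpose_matrix)

lemma GDERIV_half_sqnorm:
  fixes A :: "real ^ 'p ^ 'p"
  assumes "\<And>x y. x \<bullet> (A *v y) = (A *v x) \<bullet> y"
  shows "GDERIV (\<lambda>y. 1 / 2 * sqnorm A (y - w)) y :> A *v (y - w)"
proof -
  have lin: "((\<lambda>y. A *v (y - w)) has_derivative (\<lambda>h. A *v h)) (at y)"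
    by (rule bounded_linear.has_derivative[OF matrix_vector_mul_bounded_linear])
       (auto intro!: derivative_eq_intros)
  show ?thesis
    unfolding gderiv_def sqnorm_def
    by (rule derivative_eq_intros lin refl)+ (auto simp: assms inner_commute)
qed

lemma upper_lower_linear [simp]:
  "upper (x + y) = upper x + upper y" "lower (x + y) = lower x + lower y"
  "upper (x - y) = upper x - upper y" "lower (x - y) = lower x - lower y"
  "upper (- x) = - upper x" "lower (- x) = - lower x"
  by (auto simp: upper_def lower_def vec_eq_iff)

lemma upper_col [simp]: "upper (col x a) = x" and lower_col [simp]: "lower (col x a) = a"
  by (auto simp: upper_def lower_def col_def vec_eq_iff)

lemma upper_lower_eqI:
  assumes "upper u = upper v" "lower u = lower v"
  shows "u = v"
proof -
  have "u $ s = v $ s" for s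
    using assms by (cases s) (auto simp: upper_def lower_def vec_eq_iff)
  then show ?thesis by (simp add: vec_eq_iff)
qed

lemma inner_upper_lower: "u \<bullet> v = upper u \<bullet> upper v + lower u \<bullet> lower v"
  by (simp add: inner_vec_def upper_def lower_def sum.Plus flip: UNIV_Plus_UNIV)

lemma norm_upper_lower: "(norm u)\<^sup>2 = (norm (upper u))\<^sup>2 + (norm (lower u))\<^sup>2"
  by (simp add: power2_norm_eq_inner inner_upper_lower[of u u])

lemma norm_upper_le: "norm (upper u) \<le> norm u" and norm_lower_le: "norm (lower u) \<le> norm u"
  using norm_upper_lower[of u] by (auto intro!: power2_le_imp_le[OF _ norm_ge_zero])

lemma block_mat_mult [simp]:
  "upper (block_mat A B C D *v u) = A *v upper u + B *v lower u"
  "lower (block_mat A B C D *v u) = C *v upper u + D *v lower u"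
  by (simp_all add: block_mat_def matrix_vector_mult_def upper_def lower_def vec_eq_iff sum.Plus
        flip: UNIV_Plus_UNIV)

lemma mat_mult_vec [simp]: "mat c *v x = c *\<^sub>R (x :: real ^ 'p)"
  by (simp add: mat_def matrix_vector_mult_def vec_eq_iff if_distrib[of "\<lambda>c. c * _"] cong: if_cong)

text \<open>In block form \<open>M_mat\<close> is unit upper triangular, so changing the sign of the
  off-diagonal block inverts it.\<close>

lemma M_mat_inverse:
  defines "M' \<equiv> (\<lambda>\<tau> V. block_mat (mat 1) (- (Gamma_mat \<tau> ** V)) 0 (mat 1))"
  shows "M_mat \<tau> V ** M' \<tau> V = mat 1" "M' \<tau> V ** M_mat \<tau> V = mat 1"
proof -
  have neg: "(- A) *v x = - (A *v x)" for A :: "real ^ 'p::finite ^ 'p" and x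
    using matrix_vector_mult_diff_rdistrib[of 0 A x] by simp
  show "M_mat \<tau> V ** M' \<tau> V = mat 1" "M' \<tau> V ** M_mat \<tau> V = mat 1"
    by (auto simp: matrix_eq M_mat_def M'_def matrix_vector_mul_assoc[symmetric] neg intro!: upper_lower_eqI)
qed

text \<open>The inverse of Gamma cancels Gamma in the off-diagonal block, so the diagonal matrix
  times \<open>M_mat\<close> is \<open>Q_mat\<close>, and \<open>M_mat\<close> then cancels on the
  right. The weighted norm thus decouples into a primal and a dual part.\<close>

lemma H_mat_eq:
  assumes "\<And>i. \<tau> i \<noteq> 0"
  shows "H_mat \<tau> \<beta> V = block_mat (Gamma_mat (\<lambda>i. inverse (\<tau> i))) 0 0 (mat (1 / \<beta>))"
    (is "_ = ?D")
proof -
  have "?D ** M_mat \<tau> V = Q_mat \<tau> \<beta> V"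
    by (auto simp: matrix_eq M_mat_def Q_mat_def matrix_vector_mul_assoc[symmetric]
        matrix_inv_Gamma[of \<tau>] assms algebra_simps intro!: upper_lower_eqI agent_eqI)
  then have "H_mat \<tau> \<beta> V = ?D ** (M_mat \<tau> V ** block_mat (mat 1) (- (Gamma_mat \<tau> ** V)) 0 (mat 1))"
    unfolding H_mat_def matrix_inv_eqI[OF M_mat_inverse] by (simp only: matrix_mul_assoc)
  then show ?thesis by (simp only: M_mat_inverse matrix_mul_rid)
qed

lemma sqnorm_H_mat:
  assumes "\<And>i. \<tau> i \<noteq> 0"
  shows "sqnorm (H_mat \<tau> \<beta> V) u
    = sqnorm (Gamma_mat (\<lambda>i. inverse (\<tau> i))) (upper u) + (norm (lower u))\<^sup>2 / \<beta>"
  by (simp add: H_mat_eq[of \<tau>] assms sqnorm_def inner_upper_lower[of u] power2_norm_eq_inner)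

lemma matrix_vector_mult_bound:
  fixes A :: "real ^ 'p ^ 'q"
  obtains K where "K > 0" "\<And>x. norm (A *v x) \<le> K * norm x"
  using bounded_linear.pos_bounded[OF matrix_vector_mul_bounded_linear[of A]]
  by (metis mult.commute)

subsection \<open>The proximal step and saddle points\<close>

text \<open>\<open>prox\<close> is a choice among minimizers, so existence comes first: the metric
  is diagonal by agents, hence minimizers of the agents' problems stack to a minimizer of the whole.
  Fermat's rule then gives the inclusion.\<close>

lemma prox_subdiff:
  fixes g :: "'N::finite \<Rightarrow> real ^ 'n::finite \<Rightarrow> ereal"
  assumes g: "\<And>i. proper_fun (g i)" "\<And>i. closed_fun (g i)" "\<And>i. convex_fun (g i)"
    and p: "p \<in> subdiff (sum_G g) x0" and \<tau>: "\<And>i. 0 < \<tau> i"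
    and y: "y = prox (matrix_inv (Gamma_mat \<tau>)) (sum_G g) w"
  shows "Gamma_mat (\<lambda>i. inverse (\<tau> i)) *v (w - y) \<in> subdiff (sum_G g) y"
proof -
  let ?A = "Gamma_mat (\<lambda>i. inverse (\<tau> i)) :: real ^ ('N \<times> 'n) ^ ('N \<times> 'n)"
  let ?\<phi> = "\<lambda>z. 1 / 2 * sqnorm ?A (z - w)"
  have "\<exists>y. \<forall>z. g i y + ereal (inverse (\<tau> i) / 2 * (norm (y - agent i w))\<^sup>2)
      \<le> g i z + ereal (inverse (\<tau> i) / 2 * (norm (z - agent i w))\<^sup>2)" for i
    using prox_minimizer_exists[OF g(1,2) subdiff_agent[OF g(1) p], of "inverse (\<tau> i) / 2" i "agent i w"] \<tau>[of i]
    by (metis half_gt_zero inverse_positive_iff_positive)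
  then obtain m where m: "\<And>i z. g i (m i) + ereal (inverse (\<tau> i) / 2 * (norm (m i - agent i w))\<^sup>2)
      \<le> g i z + ereal (inverse (\<tau> i) / 2 * (norm (z - agent i w))\<^sup>2)"
    by metis
  have split: "sum_G g z + ereal (?\<phi> z)
      = (\<Sum>i\<in>UNIV. g i (agent i z) + ereal (inverse (\<tau> i) / 2 * (norm (agent i z - agent i w))\<^sup>2))" for z
    by (simp add: sum_G_def sqnorm_Gamma sum.distrib sum_divide_distrib)
  have "is_arg_min (\<lambda>z. sum_G g z + ereal (?\<phi> z)) (\<lambda>_. True) (stack m)"
    unfolding is_arg_min_linorder split using m by (auto intro!: sum_mono)
  then have "is_arg_min (\<lambda>z. sum_G g z + ereal (?\<phi> z)) (\<lambda>_. True) y"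
    unfolding y prox_def arg_min_def using \<tau>
    by (subst matrix_inv_Gamma) (auto simp: less_imp_neq[THEN not_sym] intro: someI)
  then have min: "sum_G g y + ereal (?\<phi> y) \<le> sum_G g z + ereal (?\<phi> z)" for z
    by (simp add: is_arg_min_linorder)
  obtain a where a: "sum_G g x0 = ereal a"
    by (rule subdiff_finite[OF proper_sum_G[of g, OF g(1)] p])
  have "sum_G g y \<noteq> \<infinity>" using min[of x0] by (auto simp: a)
  then have "- (?A *v (y - w)) \<in> subdiff (sum_G g) y"
    by (rule minimizer_subdiff[OF proper_sum_G[of g, OF g(1)] convex_sum_G[of g, OF g(1,3)] _
          GDERIV_half_sqnorm[OF Gamma_selfadjoint] min])
  then show ?thesis
    by (simp add: matrix_vector_mult_diff_distrib)
qed

text \<open>Maximality in the multiplier forces feasibility; minimality in the primal variable is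
  Fermat's rule for \<open>sum_G g\<close> plus the differentiable rest of the Lagrangian.\<close>

lemma saddle_point_KKT:
  assumes g: "\<And>i. proper_fun (g i)" "\<And>i. convex_fun (g i)"
    and D: "GDERIV (sum_F f) xs :> D" and V: "transpose V = V"
    and saddle: "(xs, as) \<in> saddle_points f g V"
  shows "V *v xs = 0" "V *v as - D \<in> subdiff (sum_G g) xs"
proof -
  have le: "lagrangian f g V xs a \<le> lagrangian f g V xs as"
    "lagrangian f g V xs as \<le> lagrangian f g V x as" for x a
    using saddle by (auto simp: saddle_points_def)
  obtain x1 where x1: "sum_G g x1 \<noteq> \<infinity>"
    using proper_sum_G[of g, OF g(1)] by (auto simp: proper_fun_def)
  then obtain r1 where "sum_G g x1 = ereal r1"
    using proper_sum_G[of g, OF g(1)] by (cases "sum_G g x1") (auto simp: proper_fun_def)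
  then have "sum_G g xs \<noteq> \<infinity>"
    using le(2)[of x1] by (auto simp: lagrangian_def)
  then obtain r where r: "sum_G g xs = ereal r"
    using proper_sum_G[of g, OF g(1)] by (cases "sum_G g xs") (auto simp: proper_fun_def)
  show V0: "V *v xs = 0"
  proof -
    \<comment> \<open>Moving the multiplier by \<open>- (V *v xs)\<close> raises the Lagrangian by
      the squared norm of \<open>V *v xs\<close>.\<close>
    have "(V *v xs) \<bullet> (V *v xs) \<le> 0"
      using le(1)[of "as - V *v xs"] by (simp add: lagrangian_def r inner_diff_left)
    then show ?thesis by (simp flip: power2_norm_eq_inner)
  qed
  have "((\<lambda>x. as \<bullet> (V *v x)) has_derivative (\<lambda>h. as \<bullet> (V *v h))) (at xs)"
    by (intro bounded_linear_imp_has_derivative bounded_linear_compose[OF bounded_linear_inner_right]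
        matrix_vector_mul_bounded_linear)
  then have "GDERIV (\<lambda>x. as \<bullet> (V *v x)) xs :> V *v as"
    by (simp add: gderiv_def transpose_selfadjoint[OF V, of "as"] inner_commute[of "V *v as"])
  then have D': "GDERIV (\<lambda>x. sum_F f x - as \<bullet> (V *v x)) xs :> D - V *v as"
    by (intro GDERIV_diff D)
  have "sum_G g xs + ereal (sum_F f xs - as \<bullet> (V *v xs)) \<le> sum_G g x + ereal (sum_F f x - as \<bullet> (V *v x))" for x
    using le(2)[of x] by (cases "sum_G g x") (auto simp: lagrangian_def r)
  then have "- (D - V *v as) \<in> subdiff (sum_G g) xs"
    by (rule minimizer_subdiff[OF proper_sum_G[of g, OF g(1)] convex_sum_G[of g, OF g] \<open>sum_G g xs \<noteq> \<infinity>\<close> D'])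
  then show "V *v as - D \<in> subdiff (sum_G g) xs" by simp
qed

subsection \<open>The mixing matrix\<close>

text \<open>The double sum of the nonnegative terms \<open>W $ i $ j * (x $ i + x $ j)^2\<close>
  equals \<open>2 * (x \<bullet> x) + 2 * (x \<bullet> (W *v x))\<close>, and its diagonal alone
  contributes at least \<open>4 * w * (x \<bullet> x)\<close>.\<close>

lemma doubly_stochastic_quadratic_form_ge:
  fixes W :: "real ^ 'N ^ 'N"
  assumes W: "doubly_stochastic W" and w: "\<And>i. w \<le> W $ i $ i"
  shows "(2 * w - 1) * (x \<bullet> x) \<le> x \<bullet> (W *v x)"
proof -
  have nonneg: "0 \<le> W $ i $ j" and row: "(\<Sum>j\<in>UNIV. W $ i $ j) = 1"
    and column: "(\<Sum>i\<in>UNIV. W $ i $ j) = 1" for i j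
    using W by (auto simp: doubly_stochastic_def)
  have "4 * w * (x \<bullet> x) = (\<Sum>i\<in>UNIV. w * (x $ i + x $ i)\<^sup>2)"
    by (simp add: inner_vec_def sum_distrib_left power2_eq_square algebra_simps)
  also have "\<dots> \<le> (\<Sum>i\<in>UNIV. W $ i $ i * (x $ i + x $ i)\<^sup>2)"
    using w by (intro sum_mono mult_right_mono) auto
  also have "\<dots> \<le> (\<Sum>i\<in>UNIV. \<Sum>j\<in>UNIV. W $ i $ j * (x $ i + x $ j)\<^sup>2)"
    using nonneg by (intro sum_mono member_le_sum) auto
  also have "\<dots> = (\<Sum>i\<in>UNIV. \<Sum>j\<in>UNIV. W $ i $ j * (x $ i)\<^sup>2)
      + (\<Sum>i\<in>UNIV. \<Sum>j\<in>UNIV. W $ i $ j * (x $ j)\<^sup>2)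
      + 2 * (\<Sum>i\<in>UNIV. \<Sum>j\<in>UNIV. x $ i * (W $ i $ j * x $ j))"
    by (simp add: sum.distrib sum_distrib_left power2_sum algebra_simps)
  also have "(\<Sum>i\<in>UNIV. \<Sum>j\<in>UNIV. W $ i $ j * (x $ i)\<^sup>2) = x \<bullet> x"
    by (simp add: row inner_vec_def power2_eq_square flip: sum_distrib_right)
  also have "(\<Sum>i\<in>UNIV. \<Sum>j\<in>UNIV. W $ i $ j * (x $ j)\<^sup>2) = x \<bullet> x"
    by (subst sum.swap) (simp add: column inner_vec_def power2_eq_square flip: sum_distrib_right)
  also have "(\<Sum>i\<in>UNIV. \<Sum>j\<in>UNIV. x $ i * (W $ i $ j * x $ j)) = x \<bullet> (W *v x)"
    by (simp add: inner_vec_def matrix_vector_mult_def sum_distrib_left)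
  finally show ?thesis by (simp add: algebra_simps)
qed

lemma sum_UNIV_prod:
  "(\<Sum>q\<in>UNIV. h q) = (\<Sum>a\<in>UNIV. \<Sum>b\<in>UNIV. h (a :: 'a::finite, b :: 'b::finite))"
  by (simp add: sum.cartesian_product flip: UNIV_Times_UNIV)

text \<open>\<open>kron W (mat 1)\<close> mixes the agents independently in each coordinate
  \<open>j\<close>, acting as \<open>W\<close> on the vector of their \<open>j\<close>-th
  entries.\<close>

lemma kron_mat_1_inner:
  fixes W :: "real ^ 'N::finite ^ 'N" and x :: "real ^ ('N \<times> 'n::finite)"
  shows "x \<bullet> (kron W (mat 1) *v x)
    = (\<Sum>j\<in>UNIV. (\<chi> i. x $ (i, j)) \<bullet> (W *v (\<chi> i. x $ (i, j))))"
proof -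
  have "(kron W (mat 1) *v x) $ (i, j) = (W *v (\<chi> i. x $ (i, j))) $ i" for i j
  proof -
    have "(kron W (mat 1) *v x) $ (i, j)
        = (\<Sum>i'\<in>UNIV. \<Sum>j'\<in>UNIV. if j = j' then W $ i $ i' * x $ (i', j') else 0)"
      unfolding matrix_vector_mult_def sum_UNIV_prod by (auto simp: kron_def mat_def if_distrib[of "\<lambda>c. c * _"] if_distrib[of "\<lambda>c. _ * c"]
          cong: if_cong intro!: sum.cong)
    then show ?thesis by (simp add: matrix_vector_mult_def)
  qed
  then have "x \<bullet> (kron W (mat 1) *v x)
      = (\<Sum>i\<in>UNIV. \<Sum>j\<in>UNIV. x $ (i, j) * (W *v (\<chi> i. x $ (i, j))) $ i)"
    unfolding inner_vec_def sum_UNIV_prod by simp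
  then show ?thesis
    by (subst (asm) sum.swap) (simp add: inner_vec_def)
qed

text \<open>By symmetry of \<open>V\<close> the left side is the quadratic form of
  \<open>mat 1 - kron W (mat 1)\<close>. For \<open>w > 0\<close> the factor is strictly below 2,
  which later leaves slack at the largest admissible \<beta>.\<close>

lemma psd_sqrt_mixing_bound:
  fixes W :: "real ^ 'N::finite ^ 'N" and V :: "real ^ ('N \<times> 'n::finite) ^ ('N \<times> 'n)"
  assumes W: "doubly_stochastic W" "\<And>i. w \<le> W $ i $ i"
    and V: "is_psd_sqrt V (mat 1 - kron W (mat 1))"
  shows "(norm (V *v x))\<^sup>2 \<le> 2 * (1 - w) * (norm x)\<^sup>2"
proof -
  let ?col = "\<lambda>j. (\<chi> i. x $ (i, j)) :: real ^ 'N"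
  have sym: "transpose V = V" and sq: "V ** V = mat 1 - kron W (mat 1)"
    using V by (auto simp: is_psd_sqrt_def pos_semidef_def)
  have cols: "x \<bullet> x = (\<Sum>j\<in>UNIV. ?col j \<bullet> ?col j)"
    unfolding inner_vec_def sum_UNIV_prod by (subst sum.swap) simp
  have "(norm (V *v x))\<^sup>2 = x \<bullet> ((V ** V) *v x)"
    by (simp add: power2_norm_eq_inner transpose_selfadjoint[OF sym] flip: matrix_vector_mul_assoc)
  also have "\<dots> = x \<bullet> x - (\<Sum>j\<in>UNIV. ?col j \<bullet> (W *v ?col j))"
    by (simp add: sq matrix_vector_mult_diff_rdistrib inner_diff_right kron_mat_1_inner)
  also have "\<dots> \<le> x \<bullet> x - (\<Sum>j\<in>UNIV. (2 * w - 1) * (?col j \<bullet> ?col j))"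
    using doubly_stochastic_quadratic_form_ge[OF W] by (intro diff_left_mono sum_mono)
  also have "\<dots> = 2 * (1 - w) * (norm x)\<^sup>2"
    by (simp add: power2_norm_eq_inner cols algebra_simps sum.distrib sum_subtractf flip: sum_distrib_left)
  finally show ?thesis .
qed

subsection \<open>Contraction and convergence rate\<close>

text \<open>The last half of the terms up to \<open>k\<close> are all at least \<open>a k\<close>,
  so their sum, small by the Cauchy criterion, dominates \<open>(k + 1) / 2 * a k\<close>.\<close>

lemma decreasing_summable_smallo:
  fixes a :: "nat \<Rightarrow> real"
  assumes nonneg: "\<And>k. 0 \<le> a k" and dec: "\<And>k. a (Suc k) \<le> a k" and "summable a"
  shows "a \<in> o(\<lambda>k. 1 / (real k + 1))"
proof (rule landau_o.smallI)
  fix c :: real assume "c > 0"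
  then obtain N where N: "\<And>m n. m \<ge> N \<Longrightarrow> norm (sum a {m..<n}) < c / 2"
    using \<open>summable a\<close> unfolding summable_Cauchy by (meson half_gt_zero)
  have anti: "a n \<le> a m" if "m \<le> n" for m n
    using dec that by (rule lift_Suc_antimono_le)
  have "a k \<le> c * (1 / (real k + 1))" if k: "k \<ge> 2 * N" for k
  proof -
    \<comment> \<open>The window from \<open>k div 2\<close> to \<open>k\<close>, both included, has
      at least \<open>(k + 1) / 2\<close> terms for either parity; \<open>k \<ge> 2 * N\<close>
      makes it start at \<open>N\<close> or later.\<close>
    have "(real k + 1) / 2 * a k \<le> real (Suc k - k div 2) * a k"
    proof (intro mult_right_mono nonneg)
      have "k + 1 \<le> 2 * (Suc k - k div 2)" by linarith
      then have "real (k + 1) \<le> real (2 * (Suc k - k div 2))" by (rule of_nat_mono)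
      then show "(real k + 1) / 2 \<le> real (Suc k - k div 2)" by (simp only: of_nat_mult of_nat_add) simp
    qed
    also have "\<dots> = (\<Sum>j\<in>{k div 2..<Suc k}. a k)" by simp
    also have "\<dots> \<le> sum a {k div 2..<Suc k}" by (intro sum_mono anti) auto
    also have "\<dots> \<le> norm (sum a {k div 2..<Suc k})" by (simp only: real_norm_def abs_ge_self)
    also have "\<dots> \<le> c / 2" using k by (intro less_imp_le[OF N]) simp
    finally show ?thesis by (simp add: field_simps)
  qed
  then show "\<forall>\<^sub>F k in sequentially. norm (a k) \<le> c * norm (1 / (real k + 1))"
    using nonneg by (auto intro!: eventually_sequentiallyI[of "2 * N"])
qed

lemma grad_sum_F:
  assumes "\<And>i. smooth_with (L i) (f i)"
  shows "grad (sum_F f) z = stack (\<lambda>i. grad (f i) (agent i z))"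
  using assms by (intro grad_eqI GDERIV_sum_F GDERIV_grad) (auto simp: smooth_with_def)

lemma grad_sum_F_lipschitz:
  assumes "\<And>i. smooth_with (L i) (f i)"
  obtains K where "K \<ge> 0" "\<And>x y. norm (grad (sum_F f) x - grad (sum_F f) y) \<le> K * norm (x - y)"
proof
  \<comment> \<open>Any Lipschitz constant serves, since it enters only the constant of the residual
    bound; a root of summed squares suits the blockwise norm.\<close>
  define K where "K = sqrt (\<Sum>i\<in>UNIV. (L i)\<^sup>2)"
  have K2: "K\<^sup>2 = (\<Sum>i\<in>UNIV. (L i)\<^sup>2)" unfolding K_def by (simp add: sum_nonneg)
  show "K \<ge> 0" unfolding K_def by (simp add: sum_nonneg)
  fix x y
  have "(norm (grad (sum_F f) x - grad (sum_F f) y))\<^sup>2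
      = (\<Sum>i\<in>UNIV. (norm (grad (f i) (agent i x) - grad (f i) (agent i y)))\<^sup>2)"
    by (simp add: norm_agents grad_sum_F[of L, OF assms])
  also have "\<dots> \<le> (\<Sum>i\<in>UNIV. (L i)\<^sup>2 * (norm (x - y))\<^sup>2)"
  proof (rule sum_mono)
    fix i
    have lip: "(L i)-lipschitz_on UNIV (grad (f i))" using assms[of i] by (simp add: smooth_with_def)
    have "norm (agent i x - agent i y) \<le> norm (x - y)"
      by (rule power2_le_imp_le) (auto simp: norm_agents[of "x - y"]
          intro: member_le_sum[of i UNIV "\<lambda>i. (norm (agent i x - agent i y))\<^sup>2"])
    then have "L i * norm (agent i x - agent i y) \<le> L i * norm (x - y)"
      using lipschitz_on_nonneg[OF lip] by (rule mult_left_mono)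
    then have "norm (grad (f i) (agent i x) - grad (f i) (agent i y)) \<le> L i * norm (x - y)"
      using lipschitz_onD[OF lip, of "agent i x" "agent i y"] by (simp add: dist_norm)
    then show "(norm (grad (f i) (agent i x) - grad (f i) (agent i y)))\<^sup>2 \<le> (L i)\<^sup>2 * (norm (x - y))\<^sup>2"
      by (metis norm_ge_zero power_mono power_mult_distrib)
  qed
  also have "\<dots> = (K * norm (x - y))\<^sup>2"
    by (simp add: K2 power_mult_distrib sum_distrib_right)
  finally show "norm (grad (sum_F f) x - grad (sum_F f) y) \<le> K * norm (x - y)"
    by (rule power2_le_imp_le) (use \<open>K \<ge> 0\<close> in simp)
qed

text \<open>Monotonicity of the subdifferential is paired with the difference \<open>s\<close> of
  the predictions. Expanding the squared norms around \<open>s\<close> and the predicted dual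
  difference \<open>t\<close> yields cross terms that add up to twice this pairing. Inclusions stand
  in for proximal steps, so that a saddle point can take the place of one iterate.\<close>

lemma contraction_estimate:
  fixes f :: "'N::finite \<Rightarrow> real ^ 'n::finite \<Rightarrow> real"
    and V :: "real ^ ('N \<times> 'n) ^ ('N \<times> 'n)" and \<tau> :: "'N \<Rightarrow> real"
  defines "D \<equiv> Gamma_mat (\<lambda>i. inverse (\<tau> i)) :: real ^ ('N \<times> 'n) ^ ('N \<times> 'n)"
  assumes f: "\<And>i. L i > 0" "\<And>i. convex_on UNIV (f i)" "\<And>i. smooth_with (L i) (f i)"
    and g: "\<And>i. proper_fun (g i)" and V: "transpose V = V" and \<tau>: "\<And>i. 0 < \<tau> i" and "\<beta> > 0"
    and p: "D *v (x - xt) - grad (sum_F f) x + V *v \<alpha> \<in> subdiff (sum_G g) xt"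
    and q: "D *v (y - yt) - grad (sum_F f) y + V *v \<eta> \<in> subdiff (sum_G g) yt"
    and dual: "\<alpha>t = \<alpha> - \<beta> *\<^sub>R (V *v xt)" "\<eta>t = \<eta> - \<beta> *\<^sub>R (V *v yt)"
    and primal: "x' = xt - Gamma_mat \<tau> *v (V *v (\<alpha> - \<alpha>t))" "y' = yt - Gamma_mat \<tau> *v (V *v (\<eta> - \<eta>t))"
    and a: "a = (x - y) - (xt - yt)" and b: "b = (\<alpha> - \<eta>) - (\<alpha>t - \<eta>t)"
  shows "sqnorm D (x' - y') + (norm (\<alpha>t - \<eta>t))\<^sup>2 / \<beta>
      + (\<Sum>i\<in>UNIV. (1 / \<tau> i - L i / 2) * (norm (agent i a))\<^sup>2)
      + ((norm b)\<^sup>2 / \<beta> - sqnorm (Gamma_mat \<tau>) (V *v b))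
    \<le> sqnorm D (x - y) + (norm (\<alpha> - \<eta>))\<^sup>2 / \<beta>"
proof -
  define s t where "s = xt - yt" and "t = \<alpha>t - \<eta>t"
  note grad = grad_sum_F[of L f, OF f(3)]
  have three: "(grad (f i) u - grad (f i) v) \<bullet> z \<ge> - (L i / 4) * (norm (u - v - z))\<^sup>2" for i u v z
    using f by (intro lipschitz_gradient_three_points[OF f(2) GDERIV_grad]) (auto simp: smooth_with_def)
  have "(grad (sum_F f) x - grad (sum_F f) y) \<bullet> s
      = (\<Sum>i\<in>UNIV. (grad (f i) (agent i x) - grad (f i) (agent i y)) \<bullet> agent i s)"
    unfolding grad inner_agents[of _ s] by simp
  also have "\<dots> \<ge> (\<Sum>i\<in>UNIV. - (L i / 4) * (norm (agent i x - agent i y - agent i s))\<^sup>2)"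
    by (intro sum_mono three)
  finally have coco: "(grad (sum_F f) x - grad (sum_F f) y) \<bullet> s
      \<ge> - (\<Sum>i\<in>UNIV. L i / 4 * (norm (agent i a))\<^sup>2)"
    by (simp add: a s_def sum_negf)
  have "0 \<le> (D *v a - (grad (sum_F f) x - grad (sum_F f) y) + V *v (\<alpha> - \<eta>)) \<bullet> s"
    using subdiff_monotone[OF proper_sum_G[of g, OF g] p q]
    by (simp add: a s_def algebra_simps)
  \<comment> \<open>The gradient difference is eliminated at the price of \<open>L i / 4\<close>
    times the squared mismatch \<open>a\<close> between \<open>x - y\<close> and
    \<open>s\<close>.\<close>
  with coco have VI: "0 \<le> (D *v a) \<bullet> s + (V *v (\<alpha> - \<eta>)) \<bullet> s + (\<Sum>i\<in>UNIV. L i / 4 * (norm (agent i a))\<^sup>2)"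
    by (simp add: inner_add_left inner_diff_left)
  have b_eq: "b = \<beta> *\<^sub>R (V *v s)"
    by (simp add: b dual s_def algebra_simps)
  have x_eq: "x - y = s + a" and \<alpha>_eq: "\<alpha> - \<eta> = t + b"
    by (simp_all add: a b s_def t_def)
  have "b = (\<alpha> - \<alpha>t) - (\<eta> - \<eta>t)" by (simp add: b)
  then have x'_eq: "x' - y' = s - Gamma_mat \<tau> *v (V *v b)"
    by (simp add: primal s_def matrix_vector_mult_diff_distrib)
  have D\<Gamma>: "D *v (Gamma_mat \<tau> *v z) = z" for z
    unfolding D_def using \<tau> by (intro Gamma_inverse_mult) (simp add: less_imp_neq[THEN not_sym])
  have Dsym: "z \<bullet> (D *v z') = (D *v z) \<bullet> z'" for z z'
    unfolding D_def by (rule Gamma_selfadjoint)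
  have "sqnorm D (x - y) = s \<bullet> (D *v s) + 2 * ((D *v a) \<bullet> s) + sqnorm D a"
    by (simp add: sqnorm_def x_eq matrix_vector_right_distrib inner_add
        Dsym[of a s] inner_commute[of s "D *v a"])
  moreover have "sqnorm D (x' - y') = s \<bullet> (D *v s) - 2 * (s \<bullet> (V *v b)) + sqnorm (Gamma_mat \<tau>) (V *v b)"
  proof -
    have "(Gamma_mat \<tau> *v (V *v b)) \<bullet> (D *v s) = s \<bullet> (V *v b)"
      by (subst Dsym) (simp add: D\<Gamma> inner_commute)
    then show ?thesis
      by (simp add: sqnorm_def x'_eq matrix_vector_mult_diff_distrib inner_diff D\<Gamma>
          inner_commute[of "Gamma_mat \<tau> *v (V *v b)" "V *v b"])
  qed
  moreover have "(norm (\<alpha> - \<eta>))\<^sup>2 / \<beta> = (norm t)\<^sup>2 / \<beta> + 2 * (t \<bullet> b) / \<beta> + (norm b)\<^sup>2 / \<beta>"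
    by (simp add: \<alpha>_eq power2_norm_eq_inner inner_add inner_commute add_divide_distrib)
  \<comment> \<open>The primal correction supplies the second summand, which turns the pairing with
    the new dual difference \<open>t\<close> into the pairing with the old one in
    \<open>VI\<close>.\<close>
  moreover have "(t \<bullet> b) / \<beta> + s \<bullet> (V *v b) = (V *v (\<alpha> - \<eta>)) \<bullet> s"
  proof -
    have "(t \<bullet> b) / \<beta> = (V *v t) \<bullet> s"
      using \<open>\<beta> > 0\<close> by (simp add: b_eq transpose_selfadjoint[OF V, of t s])
    then show ?thesis
      by (simp add: \<alpha>_eq matrix_vector_right_distrib inner_add_left inner_commute[of s "V *v b"])
  qed
  \<comment> \<open>Doubling \<open>VI\<close> turns \<open>L i / 4\<close> into
    \<open>L i / 2\<close>; positivity of the resulting weights is exactly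
    \<open>\<tau> i < 2 / L i\<close>.\<close>
  moreover have "sqnorm D a - 2 * (\<Sum>i\<in>UNIV. L i / 4 * (norm (agent i a))\<^sup>2)
      = (\<Sum>i\<in>UNIV. (1 / \<tau> i - L i / 2) * (norm (agent i a))\<^sup>2)"
    by (simp add: D_def sqnorm_Gamma sum_distrib_left inverse_eq_divide algebra_simps flip: sum_subtractf)
  ultimately show ?thesis
    using VI unfolding t_def[symmetric] by (simp add: add_divide_distrib)
qed

text \<open>Nonemptiness of the KKT sets belongs to the conclusion because \<open>infdist\<close> to
  the empty set is \<open>0\<close>, which would make the residual rate vacuous.\<close>

theorem theorem3:
  fixes f :: "'N::finite \<Rightarrow> real ^ 'n::finite \<Rightarrow> real"
    and g :: "'N \<Rightarrow> real ^ 'n \<Rightarrow> ereal"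
    and L \<tau> :: "'N \<Rightarrow> real" and \<beta> :: real
    and E :: "('N \<times> 'N) set"
    and W :: "real ^ 'N ^ 'N"
    and V :: "real ^ ('N \<times> 'n) ^ ('N \<times> 'n)"
    and \<epsilon> :: "nat \<Rightarrow> real"
    and d :: "nat \<Rightarrow> real ^ ('N \<times> 'n)"
    and u ut :: "nat \<Rightarrow> real ^ ('N \<times> 'n + 'N \<times> 'n)"
  assumes f: "\<And>i. L i > 0" "\<And>i. convex_on UNIV (f i)" "\<And>i. smooth_with (L i) (f i)"
    and g: "\<And>i. proper_fun (g i)" "\<And>i. closed_fun (g i)" "\<And>i. convex_fun (g i)"
    and optimal_exists:
      "\<exists>xs. is_arg_min (\<lambda>x. \<Sum>i\<in>UNIV. ereal (f i x) + g i x) (\<lambda>_. True) xs"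
    and graph: "sym E" "\<And>i j. (i, j) \<in> E\<^sup>*"
    and W: "transpose W = W" "doubly_stochastic W"
      "{v. (mat 1 - W) *v v = 0} = span {\<chi> i. 1}"
      "\<And>i j. (i, j) \<notin> E \<Longrightarrow> i \<noteq> j \<Longrightarrow> W $ i $ j = 0"
      "\<And>i j. (i, j) \<in> E \<or> i = j \<Longrightarrow> W $ i $ j > 0"
    and V: "is_psd_sqrt V (mat 1 - kron W (mat 1))"
    and saddle: "saddle_points f g V \<noteq> {}"
    and step: "\<And>i. 0 < \<tau> i" "\<And>i. \<tau> i < 2 / L i"
      "0 < \<beta>" "\<beta> \<le> 0.5 / Max (range \<tau>)"
    and errors: "\<And>k. \<epsilon> k \<ge> 0" "\<And>k i. norm (agent i (d k)) \<le> \<epsilon> k" "\<And>k. \<epsilon> k = 0"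
    and algorithm: "DiPGM f g \<tau> \<beta> V d u ut"
  shows "(\<forall>k. sqnorm (H_mat \<tau> \<beta> V) (M_mat \<tau> V *v (u (Suc k) - ut (Suc k)))
              \<le> sqnorm (H_mat \<tau> \<beta> V) (M_mat \<tau> V *v (u k - ut k))) \<and>
         (\<lambda>k. sqnorm (H_mat \<tau> \<beta> V) (u (Suc k) - u k)) \<in> o(\<lambda>k. 1 / (real k + 1)) \<and>
         (\<forall>k. KKT f g V (ut k) \<noteq> {}) \<and>
         (\<lambda>k. (infdist 0 (KKT f g V (ut k)))\<^sup>2) \<in> o(\<lambda>k. 1 / (real k + 1))"
proof -

  \<comment> \<open>Weighted norm, and one iteration as an inclusion\<close>
  let ?M = "M_mat \<tau> V"
  let ?D = "Gamma_mat (\<lambda>i. inverse (\<tau> i)) :: real ^ ('N \<times> 'n) ^ ('N \<times> 'n)"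
  let ?gF = "grad (sum_F f)"
  \<comment> \<open>Shadows the edge set of the statement: from here on \<open>E\<close> is the
    squared weighted norm.\<close>
  define E where "E z = sqnorm (H_mat \<tau> \<beta> V) z" for z
  define w where "w k = u k - ut k" for k
  define s where "s k = E (?M *v w k)" for k
  have \<tau>0: "\<tau> i \<noteq> 0" for i using step(1)[of i] by simp
  have E_eq: "E z = sqnorm ?D (upper z) + (norm (lower z))\<^sup>2 / \<beta>" for z
    unfolding E_def using \<tau>0 by (rule sqnorm_H_mat)
  have symV: "transpose V = V" using V by (simp add: is_psd_sqrt_def pos_semidef_def)
  have dF: "GDERIV (sum_F f) z :> ?gF z" for z
    unfolding grad_sum_F[of L f, OF f(3)]
    using f(3) by (intro GDERIV_sum_F GDERIV_grad) (simp add: smooth_with_def)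
  have d0: "d k = 0" for k
    using errors(2)[of _ k] by (intro agent_eqI) (simp add: errors(3))

  \<comment> \<open>Current point, prediction and corrected point, with the proximal map replaced by
    its optimality condition; this form fits both the iterates and a saddle point.\<close>
  define is_step where "is_step z zt z' \<longleftrightarrow>
      ?D *v (upper z - upper zt) - ?gF (upper z) + V *v lower z \<in> subdiff (sum_G g) (upper zt) \<and>
      lower zt = lower z - \<beta> *\<^sub>R (V *v upper zt) \<and>
      upper z' = upper zt - Gamma_mat \<tau> *v (V *v (lower z - lower zt)) \<and> lower z' = lower zt" for z zt z'

  obtain xs as where "(xs, as) \<in> saddle_points f g V" using saddle by auto
  note KKT_star = saddle_point_KKT[OF g(1,3) dF symV this]
  define us where "us = col xs as"
  \<comment> \<open>Feasibility \<open>V *v xs = 0\<close> keeps the dual part fixed, and the KKT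
    inclusion is the proximal optimality condition at a fixed point.\<close>
  have step_star: "is_step us us us"
    using KKT_star by (simp add: is_step_def us_def add.commute)

  have alg: "upper (ut k) = prox (matrix_inv (Gamma_mat \<tau>)) (sum_G g)
        (upper (u k) - Gamma_mat \<tau> *v (?gF (upper (u k)) - V *v lower (u k)))"
      "lower (ut k) = lower (u k) - \<beta> *\<^sub>R (V *v upper (ut k))"
      "u (Suc k) = u k - ?M *v w k" for k
    using algorithm by (auto simp: DiPGM_def d0 w_def)
  have step_u: "is_step (u k) (ut k) (u (Suc k))" for k
  proof -
    \<comment> \<open>The subgradient at \<open>xs\<close> from the saddle point makes the proximal
      problem coercive, so that \<open>prox\<close> is a true minimizer.\<close>
    have "?D *v (upper (u k) - Gamma_mat \<tau> *v (?gF (upper (u k)) - V *v lower (u k)) - upper (ut k))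
        \<in> subdiff (sum_G g) (upper (ut k))"
      using g KKT_star(2) step(1) alg(1) by (rule prox_subdiff)
    then have "?D *v (upper (u k) - upper (ut k)) - ?gF (upper (u k)) + V *v lower (u k)
        \<in> subdiff (sum_G g) (upper (ut k))"
      by (simp add: matrix_vector_mult_diff_distrib Gamma_inverse_mult \<tau>0 algebra_simps)
    moreover have "upper (u (Suc k)) = upper (ut k) - Gamma_mat \<tau> *v (V *v (lower (u k) - lower (ut k)))"
        "lower (u (Suc k)) = lower (ut k)"
      by (simp_all add: alg(3) w_def M_mat_def matrix_vector_mul_assoc[symmetric])
    ultimately show ?thesis by (simp add: is_step_def alg(2))
  qed

  \<comment> \<open>Slack constants and contraction of one step\<close>
  define c1 where "c1 = Min (range (\<lambda>i. 1 / \<tau> i - L i / 2))"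
  define \<omega> where "\<omega> = Min (range (\<lambda>i. W $ i $ i))"
  define T where "T = Max (range \<tau>)"
  define c where "c = min c1 (\<omega> / \<beta>)"
  have c1: "c1 \<le> 1 / \<tau> i - L i / 2" and \<omega>: "\<omega> \<le> W $ i $ i" and T: "\<tau> i \<le> T" for i
    by (simp_all add: c1_def \<omega>_def T_def)
  \<comment> \<open>The primal slack comes from the step sizes, the dual slack from the self-weights
    \<open>W $ i $ i\<close>, positive by the case \<open>i = j\<close> of
    \<open>W(5)\<close>.\<close>
  have "c1 > 0"
    using step(1,2) f(1) by (auto simp: c1_def Min_gr_iff field_simps)
  moreover have "\<omega> > 0"
    using W(5) by (auto simp: \<omega>_def Min_gr_iff)
  ultimately have "c > 0" using step(3) by (simp add: c_def)
  have "T > 0" using T step(1) by (meson less_le_trans)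
  then have T\<beta>: "T \<le> 1 / (2 * \<beta>)"
    using step(3,4) by (simp add: T_def field_simps)
  have contr: "E (z1' - z2') + c * (norm ((z1 - z2) - (v1 - v2)))\<^sup>2 \<le> E (z1 - z2)"
    if "is_step z1 v1 z1'" "is_step z2 v2 z2'" for z1 v1 z1' z2 v2 z2'
  proof -
    define a b where "a = upper ((z1 - z2) - (v1 - v2))" and "b = lower ((z1 - z2) - (v1 - v2))"
    have "sqnorm ?D (upper z1' - upper z2') + (norm (lower v1 - lower v2))\<^sup>2 / \<beta>
        + (\<Sum>i\<in>UNIV. (1 / \<tau> i - L i / 2) * (norm (agent i a))\<^sup>2)
        + ((norm b)\<^sup>2 / \<beta> - sqnorm (Gamma_mat \<tau>) (V *v b))
      \<le> sqnorm ?D (upper z1 - upper z2) + (norm (lower z1 - lower z2))\<^sup>2 / \<beta>"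
      using that by (intro contraction_estimate[OF f g(1) symV step(1,3)])
        (auto simp: is_step_def a_def b_def)
    then have main: "E (z1' - z2') + (\<Sum>i\<in>UNIV. (1 / \<tau> i - L i / 2) * (norm (agent i a))\<^sup>2)
        + ((norm b)\<^sup>2 / \<beta> - sqnorm (Gamma_mat \<tau>) (V *v b)) \<le> E (z1 - z2)"
      using that by (simp add: E_eq is_step_def)
    have "c * (norm a)\<^sup>2 \<le> (\<Sum>i\<in>UNIV. (1 / \<tau> i - L i / 2) * (norm (agent i a))\<^sup>2)"
      unfolding norm_agents[of a] sum_distrib_left
      using c1 by (intro sum_mono mult_right_mono) (auto simp: c_def intro: min.coboundedI1)
    moreover have "c * (norm b)\<^sup>2 \<le> (norm b)\<^sup>2 / \<beta> - sqnorm (Gamma_mat \<tau>) (V *v b)"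
    proof -
      have "sqnorm (Gamma_mat \<tau>) (V *v b) \<le> T * (norm (V *v b))\<^sup>2"
        unfolding sqnorm_Gamma norm_agents[of "V *v b"] sum_distrib_left
        using T by (intro sum_mono mult_right_mono) auto
      \<comment> \<open>The factor \<open>1 - \<omega>\<close> leaves a share
        \<open>\<omega> / \<beta>\<close> even when \<beta> attains its upper bound.\<close>
      also have "\<dots> \<le> 1 / (2 * \<beta>) * (2 * (1 - \<omega>) * (norm b)\<^sup>2)"
        using psd_sqrt_mixing_bound[OF W(2) \<omega> V, of b] T\<beta> step(3) by (intro mult_mono) auto
      also have "\<dots> = (norm b)\<^sup>2 / \<beta> - \<omega> / \<beta> * (norm b)\<^sup>2"
        using step(3) by (simp add: field_simps)
      also have "\<dots> \<le> (norm b)\<^sup>2 / \<beta> - c * (norm b)\<^sup>2"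
        by (intro diff_left_mono mult_right_mono) (auto simp: c_def)
      finally show ?thesis by linarith
    qed
    moreover have "(norm ((z1 - z2) - (v1 - v2)))\<^sup>2 = (norm a)\<^sup>2 + (norm b)\<^sup>2"
      unfolding a_def b_def by (rule norm_upper_lower)
    ultimately show ?thesis using main by (simp add: distrib_left)
  qed

  \<comment> \<open>Control of the Euclidean norm by the weighted norm\<close>
  have E_lower: "(norm z)\<^sup>2 \<le> (T + \<beta>) * E z" for z
  proof -
    have "(norm (upper z))\<^sup>2 = (\<Sum>i\<in>UNIV. \<tau> i * (inverse (\<tau> i) * (norm (agent i (upper z)))\<^sup>2))"
      using \<tau>0 by (simp add: norm_agents[of "upper z"] flip: mult.assoc)
    also have "\<dots> \<le> T * sqnorm ?D (upper z)"
      unfolding sqnorm_Gamma sum_distrib_left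
      using T step(1) by (intro sum_mono mult_right_mono) (auto simp: less_imp_le)
    finally have "(norm (upper z))\<^sup>2 \<le> T * sqnorm ?D (upper z)" .
    moreover have "0 \<le> sqnorm ?D (upper z)"
      unfolding sqnorm_Gamma using step(1) by (intro sum_nonneg) (auto simp: less_imp_le)
    \<comment> \<open>Since these cross products are nonnegative, the sum \<open>T + \<beta>\<close>
      of the two block constants serves for the whole vector.\<close>
    then have "0 \<le> \<beta> * sqnorm ?D (upper z)" "0 \<le> T * ((norm (lower z))\<^sup>2 / \<beta>)"
      using \<open>T > 0\<close> step(3) by simp_all
    moreover have "\<beta> * ((norm (lower z))\<^sup>2 / \<beta>) = (norm (lower z))\<^sup>2"
      using step(3) by simp
    ultimately show ?thesis
      unfolding norm_upper_lower[of z] E_eq distrib_left distrib_right by linarith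
  qed
  have E_nonneg: "0 \<le> E z" for z
    using order_trans[OF zero_le_power2 E_lower[of z]] \<open>T > 0\<close> step(3) by (simp add: zero_le_mult_iff)

  \<comment> \<open>Monotone increments and summability\<close>
  have s_fun: "s = (\<lambda>k. sqnorm (H_mat \<tau> \<beta> V) (?M *v (u k - ut k)))"
    by (simp add: fun_eq_iff s_def E_def w_def)
  have s_nonneg: "0 \<le> s k" for k by (simp add: s_def E_nonneg)
  have E_minus: "E (- z) = E z" for z
    using matrix_vector_mult_diff_distrib[of "H_mat \<tau> \<beta> V" 0 z] by (simp add: E_def sqnorm_def)
  \<comment> \<open>The correction moves \<open>u k\<close> by exactly
    \<open>M_mat \<tau> V *v w k\<close>, so the monotone quantity is the successive difference
    itself; next the trajectory is compared with its own shift.\<close>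
  have s_eq: "s k = E (u k - u (Suc k))" for k
    by (simp add: s_def alg(3))
  have s_dec: "s (Suc k) \<le> s k" for k
  proof -
    have "0 \<le> c * (norm ((u k - u (Suc k)) - (ut k - ut (Suc k))))\<^sup>2" using \<open>c > 0\<close> by simp
    with contr[OF step_u[of k] step_u[of "Suc k"]] show ?thesis by (simp add: s_eq)
  qed
  \<comment> \<open>Telescoping against the saddle point: \<open>us\<close> is its own prediction,
    so the mismatch in \<open>contr\<close> reduces to \<open>w n\<close>.\<close>
  have "(\<Sum>k<n. c * (norm (w k))\<^sup>2) \<le> E (u 0 - us) - E (u n - us)" for n
  proof (induction n)
    case (Suc n)
    with contr[OF step_u[of n] step_star] show ?case by (simp add: w_def)
  qed simp
  then have "(\<Sum>k<n. c * (norm (w k))\<^sup>2) \<le> E (u 0 - us)" for n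
    using E_nonneg by (smt (verit))
  then have "summable (\<lambda>k. c * (norm (w k))\<^sup>2)"
    using \<open>c > 0\<close> by (intro summableI_nonneg_bounded) auto
  then have sum_w: "summable (\<lambda>k. (norm (w k))\<^sup>2)"
    using \<open>c > 0\<close> by (simp add: summable_cmult_iff)

  \<comment> \<open>Rate of the successive differences\<close>
  obtain KH where KH: "KH > 0" "\<And>z. norm (H_mat \<tau> \<beta> V *v z) \<le> KH * norm z"
    by (rule matrix_vector_mult_bound[of "H_mat \<tau> \<beta> V"]) (rule that)
  obtain KM where KM: "KM > 0" "\<And>z. norm (?M *v z) \<le> KM * norm z"
    by (rule matrix_vector_mult_bound[of "?M"]) (rule that)
  obtain KM' where KM': "KM' > 0"
    "\<And>z. norm (block_mat (mat 1) (- (Gamma_mat \<tau> ** V)) 0 (mat 1) *v z) \<le> KM' * norm z"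
    by (rule matrix_vector_mult_bound[of "block_mat (mat 1) (- (Gamma_mat \<tau> ** V)) 0 (mat 1)"]) (rule that)
  have "s k \<le> KH * KM\<^sup>2 * (norm (w k))\<^sup>2" for k
  proof -
    have "s k \<le> norm (?M *v w k) * norm (H_mat \<tau> \<beta> V *v (?M *v w k))"
      unfolding s_def E_def sqnorm_def by (rule norm_cauchy_schwarz)
    also have "\<dots> \<le> norm (?M *v w k) * (KH * norm (?M *v w k))"
      using KH(2) by (intro mult_left_mono) auto
    also have "\<dots> = KH * (norm (?M *v w k))\<^sup>2" by (simp add: power2_eq_square)
    also have "\<dots> \<le> KH * (KM * norm (w k))\<^sup>2"
      using KH(1) KM(2) by (intro mult_left_mono power_mono) auto
    finally show ?thesis by (simp add: power_mult_distrib)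
  qed
  then have "summable s"
    using s_nonneg by (intro summable_comparison_test'[OF summable_mult[OF sum_w]]) auto
  then have s_o: "s \<in> o(\<lambda>k. 1 / (real k + 1))"
    by (intro decreasing_summable_smallo s_nonneg s_dec)
  \<comment> \<open>Invertibility of \<open>M_mat\<close> passes the rate of \<open>s\<close> back
    to the uncorrected difference \<open>w\<close>.\<close>
  have w_s: "(norm (w k))\<^sup>2 \<le> KM'\<^sup>2 * (T + \<beta>) * s k" for k
  proof -
    have "norm (w k) \<le> KM' * norm (?M *v w k)"
      using KM'(2)[of "?M *v w k"] by (simp add: matrix_vector_mul_assoc M_mat_inverse)
    then have "(norm (w k))\<^sup>2 \<le> (KM' * norm (?M *v w k))\<^sup>2" by (intro power_mono) auto
    also have "\<dots> \<le> KM'\<^sup>2 * ((T + \<beta>) * s k)"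
      unfolding power_mult_distrib s_def by (intro mult_left_mono E_lower) auto
    finally show ?thesis by (simp add: mult.assoc)
  qed

  \<comment> \<open>Optimality residual at the predictions\<close>
  define r where "r k = col (?D *v upper (w k) - (?gF (upper (u k)) - ?gF (upper (ut k))) + V *v lower (w k))
    (V *v upper (ut k))" for k
  have r_KKT: "r k \<in> KKT f g V (ut k)" for k
  proof -
    \<comment> \<open>The proximal subgradient is completed to a KKT element by moving gradient and
      multiplier from \<open>u k\<close> to \<open>ut k\<close>; only differences controlled by
      \<open>w k\<close> remain.\<close>
    have eq: "?D *v upper (w k) - (?gF (upper (u k)) - ?gF (upper (ut k))) + V *v lower (w k)
        = (?D *v (upper (u k) - upper (ut k)) - ?gF (upper (u k)) + V *v lower (u k))
          + ?gF (upper (ut k)) - V *v lower (ut k)"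
      by (simp add: w_def matrix_vector_mult_diff_distrib)
    then show ?thesis
      using step_u[of k] unfolding r_def eq KKT_def is_step_def by blast
  qed
  obtain KD where KD: "KD > 0" "\<And>z. norm (?D *v z) \<le> KD * norm z"
    by (rule matrix_vector_mult_bound[of "?D"]) (rule that)
  obtain KV where KV: "KV > 0" "\<And>z. norm (V *v z) \<le> KV * norm z"
    by (rule matrix_vector_mult_bound[of "V"]) (rule that)
  obtain KF where KF: "KF \<ge> 0" "\<And>x y. norm (?gF x - ?gF y) \<le> KF * norm (x - y)"
    using grad_sum_F_lipschitz[of L f, OF f(3)] by metis
  define KR where "KR = (KD + KF + KV)\<^sup>2 + (1 / \<beta>)\<^sup>2"
  have r_bound: "(norm (r k))\<^sup>2 \<le> KR * (norm (w k))\<^sup>2" for k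
  proof -
    have "norm (upper (r k)) \<le> norm (?D *v upper (w k)) + norm (?gF (upper (u k)) - ?gF (upper (ut k)))
        + norm (V *v lower (w k))"
      unfolding r_def by (simp add: norm_triangle_le norm_triangle_le_diff)
    also have "\<dots> \<le> KD * norm (upper (w k)) + KF * norm (upper (w k)) + KV * norm (lower (w k))"
      using KD(2) KV(2) KF(2)[of "upper (u k)" "upper (ut k)"] by (intro add_mono) (auto simp: w_def)
    also have "\<dots> \<le> KD * norm (w k) + KF * norm (w k) + KV * norm (w k)"
      using KD(1) KV(1) KF(1) by (intro add_mono mult_left_mono norm_upper_le norm_lower_le) auto
    finally have "norm (upper (r k)) \<le> (KD + KF + KV) * norm (w k)" by (simp add: algebra_simps)
    then have "(norm (upper (r k)))\<^sup>2 \<le> (KD + KF + KV)\<^sup>2 * (norm (w k))\<^sup>2"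
      by (metis norm_ge_zero power_mono power_mult_distrib)
    \<comment> \<open>The dual update identifies the feasibility residual with the dual difference
      divided by \<beta>.\<close>
    moreover have "lower (w k) = \<beta> *\<^sub>R lower (r k)"
      by (simp add: w_def r_def alg(2))
    then have "lower (r k) = (1 / \<beta>) *\<^sub>R lower (w k)"
      using step(3) by simp
    then have "(norm (lower (r k)))\<^sup>2 = (1 / \<beta>)\<^sup>2 * (norm (lower (w k)))\<^sup>2"
      by (simp add: power_divide)
    then have "(norm (lower (r k)))\<^sup>2 \<le> (1 / \<beta>)\<^sup>2 * (norm (w k))\<^sup>2"
      using norm_lower_le[of "w k"] by (simp add: mult_left_mono power_mono divide_right_mono)
    ultimately show ?thesis
      by (simp add: norm_upper_lower[of "r k"] KR_def distrib_right)
  qed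
  have "(infdist 0 (KKT f g V (ut k)))\<^sup>2 \<le> KR * (KM'\<^sup>2 * (T + \<beta>)) * s k" for k
  proof -
    have "(infdist 0 (KKT f g V (ut k)))\<^sup>2 \<le> (norm (r k))\<^sup>2"
      using infdist_le[OF r_KKT, of 0 k] by (intro power_mono infdist_nonneg) simp
    also have "\<dots> \<le> KR * (norm (w k))\<^sup>2" by (rule r_bound)
    also have "\<dots> \<le> KR * (KM'\<^sup>2 * (T + \<beta>) * s k)"
      by (intro mult_left_mono w_s) (simp add: KR_def)
    finally show ?thesis by (simp add: mult.assoc)
  qed
  then have "(\<lambda>k. (infdist 0 (KKT f g V (ut k)))\<^sup>2) \<in> O(s)"
    using s_nonneg by (intro bigoI[of _ "KR * (KM'\<^sup>2 * (T + \<beta>))"] always_eventually) simp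
  then have "(\<lambda>k. (infdist 0 (KKT f g V (ut k)))\<^sup>2) \<in> o(\<lambda>k. 1 / (real k + 1))"
    using s_o by (rule landau_o.big_small_trans)
  moreover have "sqnorm (H_mat \<tau> \<beta> V) (u (Suc k) - u k) = s k" for k
    using E_minus[of "u k - u (Suc k)"] by (simp add: s_eq E_def)
  ultimately show ?thesis
    using s_dec s_o r_KKT by (auto simp: s_fun)
qed

end
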